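(* Let $\lambda$ be a partition, and let $\mathcal{S}(\lambda)$ denote the set of all plane overpartitions of shape $\lambda$. Then $$\sum_{\Pi \in \mathcal{S}(\lambda)} a^{o(\Pi)}q^{|\Pi|}=q^{\sum_i i\lambda_i}\prod_{(i,j)\in\lambda}\frac{1+aq^{c_{i,j}}}{1-q^{h_{i,j}}}.$$
   Context: A partition $\lambda=(\lambda_1\ge\lambda_2\ge\dots\ge\lambda_\ell>0)$ is identified with its Ferrers diagram, the set of cells $(i,j)$ with $1\le i\le \ell$, $1\le j\le\lambda_i$; $\lambda'$ is the conjugate partition. For a cell $(i,j)$, the hook length is $h_{i,j}=\lambda_i+\lambda'_j-i-j+1$ and the content is $c_{i,j}=j-i$. A plane overpartition of shape $\lambda$ is a filling of the cells of $\lambda$ with positive integers, weakly decreasing along each row (left to right) and each column (top to bottom), in which some entries are overlined subject to: (1) in each row, only the last (rightmost) occurrence of a given integer may be overlined, all other occurrences of that integer in the row being non-overlined; (2) in each column, the first (topmost) occurrence of a given integer may be overlined or not, and all other occurrences of that integer in the column are overlined. For a plane overpartition $\Pi$, $|\Pi|$ is the sum of all entries (ignoring overlines) and $o(\Pi)$ is the number of overlined entries. The identity is of formal power series in $q$ with coefficients polynomials in $a$. *)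

theory Defs
  imports "HOL-Analysis.Infinite_Sum" "HOL-Library.FuncSet"
    "HOL-Computational_Algebra.Computational_Algebra"
begin

definition is_partition :: "nat list \<Rightarrow> bool" where
  "is_partition lam \<longleftrightarrow> sorted_wrt (\<ge>) lam \<and> (\<forall>x\<in>set lam. x > 0)"

text \<open>Rows and columns are numbered from 1, whereas list positions start at 0.\<close>

definition part :: "nat list \<Rightarrow> nat \<Rightarrow> nat" where
  "part lam i = lam ! (i - 1)"

definition cells :: "nat list \<Rightarrow> (nat \<times> nat) set" where
  "cells lam = {(i, j). 1 \<le> i \<and> i \<le> length lam \<and> 1 \<le> j \<and> j \<le> part lam i}"

definition conj_part :: "nat list \<Rightarrow> nat \<Rightarrow> nat" where
  "conj_part lam j = card {i. (i, j) \<in> cells lam}"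

definition hook :: "nat list \<Rightarrow> nat \<Rightarrow> nat \<Rightarrow> int" where
  "hook lam i j = int (part lam i) + int (conj_part lam j) - int i - int j + 1"

definition cell_content :: "nat \<Rightarrow> nat \<Rightarrow> int" where
  "cell_content i j = int j - int i"

text \<open>A filling maps each cell to its entry together with a flag telling whether the entry is
  overlined. Fillings are \<^const>\<open>undefined\<close> outside the shape, so that each one is counted once.\<close>

type_synonym filling = "nat \<times> nat \<Rightarrow> nat \<times> bool"

definition entry :: "filling \<Rightarrow> nat \<times> nat \<Rightarrow> nat" where
  "entry P c = fst (P c)"

definition overlined :: "filling \<Rightarrow> nat \<times> nat \<Rightarrow> bool" where
  "overlined P c = snd (P c)"

definition plane_overpartitions :: "nat list \<Rightarrow> filling set" where
  "plane_overpartitions lam =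
    {P \<in> cells lam \<rightarrow>\<^sub>E {0<..} \<times> UNIV.
      (\<forall>i j j'. (i, j) \<in> cells lam \<and> (i, j') \<in> cells lam \<and> j < j' \<longrightarrow>
         entry P (i, j) \<ge> entry P (i, j')) \<and>
      (\<forall>i i' j. (i, j) \<in> cells lam \<and> (i', j) \<in> cells lam \<and> i < i' \<longrightarrow>
         entry P (i, j) \<ge> entry P (i', j)) \<and>
      (\<forall>i j j'. (i, j) \<in> cells lam \<and> (i, j') \<in> cells lam \<and> j < j' \<and>
         entry P (i, j) = entry P (i, j') \<longrightarrow> \<not> overlined P (i, j)) \<and>
      (\<forall>i i' j. (i, j) \<in> cells lam \<and> (i', j) \<in> cells lam \<and> i < i' \<and>
         entry P (i, j) = entry P (i', j) \<longrightarrow> overlined P (i', j))}"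

definition size_of :: "nat list \<Rightarrow> filling \<Rightarrow> nat" where
  "size_of lam P = (\<Sum>c\<in>cells lam. entry P c)"

definition num_overlined :: "nat list \<Rightarrow> filling \<Rightarrow> nat" where
  "num_overlined lam P = card {c \<in> cells lam. overlined P c}"

text \<open>Contents may be negative, so the identity is stated for Laurent series in \<open>q\<close>. Their
  coefficient ring \<open>\<int>[a]\<close> is embedded in its fraction field, over which division of Laurent series
  is available; the topology is the \<open>q\<close>-adic one.\<close>

definition qvar :: "int poly fract fls" where
  "qvar = fls_X"

definition avar :: "int poly fract fls" where
  "avar = fls_const (to_fract [:0, 1:])"

end

theory Submission
  imports Defs "Jordan_Normal_Form.Determinant"
begin

text \<open>Put \<open>g m = (\<Prod>i = 1..m. (1 + a q\<^sup>i) / (1 - q\<^sup>i))\<close> and \<open>h m = g m - g (m - 1)\<close>; the \<open>q\<close>-binomial recursion says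
  \<open>h m = q\<^sup>m (g m + a g (m - 1))\<close>. Let \<open>J \<rho>\<close> be the Jacobi-Trudi determinant of \<open>h (\<rho>\<^sub>i - i + j)\<close>.

  By row operations, the determinant of \<open>g (\<nu>\<^sub>i - i + j)\<close> is the sum of \<open>J \<mu>\<close> over all \<open>\<mu>\<close> such that
  \<open>\<nu>/\<mu>\<close> is a horizontal strip, and by multilinearity \<open>q\<^bsup>-|\<rho>|\<^esup> J \<rho>\<close> is the sum of \<open>a\<^bsup>|\<rho>/\<nu>|\<^esup>\<close> times these
  determinants over all \<open>\<nu>\<close> such that \<open>\<rho>/\<nu>\<close> is a vertical strip. The same recursion holds for the
  generating function of plane overpartitions: the overlined ones form a vertical strip, the other
  ones a horizontal strip, and decreasing the remaining entries by one gives a plane overpartition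
  of shape \<open>\<mu>\<close>. Since the empty shape is the only one of size zero, the recursion determines all
  coefficients.

  For the product formula, \<open>h (l - k)\<close> is a function of \<open>l\<close> times a polynomial in \<open>q\<^sup>l\<close> of degree below
  the number of rows, so that \<open>J\<close> is up to a constant a product of a Vandermonde determinant and a
  factor for each row. The hook lengths of row \<open>i\<close> complement the differences \<open>l\<^sub>i - l\<^sub>k\<close> to \<open>{1..l\<^sub>i}\<close>.\<close>

section \<open>Determinants\<close>

lemma det_mat:
  "det (mat n n f) = (\<Sum>p | p permutes {0..<n}. signof p * (\<Prod>i = 0..<n. f (i, p i)))"
proof -
  have "(\<Prod>i = 0..<n. mat n n f $$ (i, p i)) = (\<Prod>i = 0..<n. f (i, p i))"
    if "p permutes {0..<n}" for p
  proof (rule prod.cong)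
    fix i assume "i \<in> {0..<n}"
    then have "i < n" "p i < n"
      using permutes_in_image[OF that, of i] by auto
    then show "mat n n f $$ (i, p i) = f (i, p i)"
      by simp
  qed simp
  then show ?thesis
    by (subst det_def'[where n = n]) auto
qed

lemma det_mat_cong:
  assumes "\<And>i j. i < n \<Longrightarrow> j < n \<Longrightarrow> f i j = g i j"
  shows "det (mat n n (\<lambda>(i, j). f i j)) = det (mat n n (\<lambda>(i, j). g i j))"
  by (rule arg_cong[of _ _ det], rule eq_matI) (use assms in auto)

text \<open>Multilinearity: expanding every row means choosing one summand per row, and the choices
  are the functions \<open>\<mu>\<close>. Matrix rows start at 0 and parts at 1, hence
  \<open>Suc i\<close>.\<close>

lemma det_sum_rows:
  fixes F :: "nat \<Rightarrow> nat \<Rightarrow> 'm \<Rightarrow> 'a :: comm_ring_1"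
  assumes fin: "\<And>i. i \<in> {1..n} \<Longrightarrow> finite (I i)"
  shows "det (mat n n (\<lambda>(i, j). \<Sum>m\<in>I (Suc i). F i j m)) =
    (\<Sum>\<mu>\<in>PiE {1..n} I. det (mat n n (\<lambda>(i, j). F i j (\<mu> (Suc i)))))"
proof -
  have "(\<Prod>i = 0..<n. \<Sum>m\<in>I (Suc i). F i (p i) m) =
      (\<Sum>\<mu>\<in>PiE {1..n} I. \<Prod>i = 0..<n. F i (p i) (\<mu> (Suc i)))" for p
  proof -
    have "(\<Prod>i = 0..<n. \<Sum>m\<in>I (Suc i). F i (p i) m) =
        (\<Prod>i\<in>{1..n}. \<Sum>m\<in>I i. F (i - 1) (p (i - 1)) m)"
      by (simp add: prod.atLeast1_atMost_eq atLeast0LessThan)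
    also have "\<dots> = (\<Sum>\<mu>\<in>PiE {1..n} I. \<Prod>i\<in>{1..n}. F (i - 1) (p (i - 1)) (\<mu> i))"
      by (rule prod_sum_PiE) (use fin in auto)
    finally show ?thesis
      by (simp add: prod.atLeast1_atMost_eq atLeast0LessThan)
  qed
  then show ?thesis
    unfolding det_mat by (simp add: sum_distrib_left) (rule sum.swap)
qed

lemma det_scale_rows:
  fixes F :: "nat \<Rightarrow> nat \<Rightarrow> 'a :: comm_ring_1"
  shows "det (mat n n (\<lambda>(i, j). c i * F i j)) = (\<Prod>i<n. c i) * det (mat n n (\<lambda>(i, j). F i j))"
  unfolding det_mat
  by (simp add: prod.distrib sum_distrib_left atLeast0LessThan mult.left_commute)

lemma det_scale_rows_cols:
  fixes F :: "nat \<Rightarrow> nat \<Rightarrow> 'a :: comm_ring_1"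
  shows "det (mat n n (\<lambda>(i, j). c i * d j * F i j)) =
    (\<Prod>i<n. c i) * (\<Prod>j<n. d j) * det (mat n n (\<lambda>(i, j). F i j))"
proof -
  have "(\<Prod>i<n. d (p i)) = (\<Prod>j<n. d j)" if "p permutes {0..<n}" for p
    using prod.permute[OF that, of d] by (simp add: atLeast0LessThan)
  then show ?thesis
    unfolding det_mat sum_distrib_left
    by (intro sum.cong) (simp_all add: prod.distrib atLeast0LessThan mult.left_commute mult.assoc)
qed

lemma det_unitriangular:
  assumes "\<And>i j. i < n \<Longrightarrow> j < i \<Longrightarrow> f i j = 0" "\<And>i. i < n \<Longrightarrow> f i i = 1"
  shows "det (mat n n (\<lambda>(i, j). f i j)) = (1 :: 'a :: comm_ring_1)"
proof -
  let ?A = "mat n n (\<lambda>(i, j). f i j)"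
  have "det ?A = prod_list (diag_mat ?A)"
    by (rule det_upper_triangular) (use assms in auto)
  also have "diag_mat ?A = replicate n 1"
    by (rule nth_equalityI) (use assms(2) in \<open>auto simp: diag_mat_def\<close>)
  finally show ?thesis
    by simp
qed

lemma mat_mult_eq:
  "mat n n (\<lambda>(i, j). f i j) * mat n n (\<lambda>(i, j). g i j) =
    mat n n (\<lambda>(i, j). \<Sum>k<n. f i k * g k j)"
  by (rule eq_matI) (auto simp: scalar_prod_def atLeast0LessThan)

lemma det_mult_mat:
  fixes f :: "nat \<Rightarrow> nat \<Rightarrow> 'a :: comm_ring_1"
  shows "det (mat n n (\<lambda>(i, j). \<Sum>k<n. f i k * g k j)) =
    det (mat n n (\<lambda>(i, j). f i j)) * det (mat n n (\<lambda>(i, j). g i j))"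
  unfolding mat_mult_eq[symmetric] by (rule det_mult) auto

text \<open>Subtracting from each row the next one is multiplication by a unitriangular matrix. Row
  \<open>n\<close> lies outside the matrix and vanishes by assumption, so the last row stays as it
  is.\<close>

lemma det_diff_rows:
  fixes F :: "nat \<Rightarrow> nat \<Rightarrow> 'a :: comm_ring_1"
  assumes "\<And>j. j < n \<Longrightarrow> F n j = 0"
  shows "det (mat n n (\<lambda>(i, j). F i j - F (Suc i) j)) = det (mat n n (\<lambda>(i, j). F i j))"
proof -
  let ?U = "\<lambda>i k. if k = i then 1 else if k = Suc i then - 1 else 0 :: 'a"
  have "(\<Sum>k<n. ?U i k * F k j) = F i j - F (Suc i) j" if "i < n" "j < n" for i j
  proof -
    have "(\<Sum>k<n. ?U i k * F k j) =
        (\<Sum>k<n. (if k = i then F k j else 0) + (if k = Suc i then - F k j else 0))"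
      by (rule sum.cong) auto
    also have "\<dots> = F i j + (if Suc i < n then - F (Suc i) j else 0)"
      using that by (simp add: sum.distrib sum.delta)
    also have "\<dots> = F i j - F (Suc i) j"
      using assms[OF \<open>j < n\<close>] that by (cases "Suc i = n") auto
    finally show ?thesis .
  qed
  then have "det (mat n n (\<lambda>(i, j). F i j - F (Suc i) j)) =
      det (mat n n (\<lambda>(i, j). \<Sum>k<n. ?U i k * F k j))"
    by (intro det_mat_cong) simp
  also have "\<dots> = det (mat n n (\<lambda>(i, j). ?U i j)) * det (mat n n (\<lambda>(i, j). F i j))"
    by (rule det_mult_mat)
  also have "det (mat n n (\<lambda>(i, j). ?U i j)) = 1"
    by (rule det_unitriangular) auto
  finally show ?thesis
    by simp
qed

lemma det_mat_equal_rows: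
  fixes F :: "nat \<Rightarrow> nat \<Rightarrow> 'a :: comm_ring_1"
  assumes "r < n" "s < n" "r \<noteq> s" "\<And>j. j < n \<Longrightarrow> F r j = F s j"
  shows "det (mat n n (\<lambda>(i, j). F i j)) = 0"
  by (rule det_identical_rows[of _ n r s]) (use assms in auto)

lemma det_mat_zero_row:
  fixes F :: "nat \<Rightarrow> nat \<Rightarrow> 'a :: comm_ring_1"
  assumes "r < n" "\<And>j. j < n \<Longrightarrow> F r j = 0"
  shows "det (mat n n (\<lambda>(i, j). F i j)) = 0"
proof -
  have "(\<Prod>i = 0..<n. F i (p i)) = 0" if "p permutes {0..<n}" for p
  proof (rule prod_zero)
    have "p r < n"
      using permutes_in_image[OF that, of r] assms(1) by auto
    then show "\<exists>i\<in>{0..<n}. F i (p i) = 0"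
      using assms by (intro bexI[of _ r]) auto
  qed simp
  then show ?thesis
    unfolding det_mat by simp
qed

lemma poly_eq_sum_coeff:
  fixes p :: "'a :: comm_ring_1 poly"
  assumes "degree p < n"
  shows "poly p x = (\<Sum>k<n. x ^ k * coeff p k)"
proof -
  have "poly p x = (\<Sum>k\<le>degree p. coeff p k * x ^ k)"
    by (rule poly_altdef)
  also have "\<dots> = (\<Sum>k<n. coeff p k * x ^ k)"
    by (rule sum.mono_neutral_left) (use assms in \<open>auto simp: coeff_eq_0\<close>)
  finally show ?thesis
    by (simp add: mult.commute)
qed

text \<open>Evaluated at the nodes, the Newton basis of polynomials gives a triangular matrix, and
  its change of basis to the monomials is unitriangular.\<close>

lemma det_poly_nodes:
  fixes y :: "nat \<Rightarrow> 'a :: idom" and p :: "nat \<Rightarrow> 'a poly"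
  assumes "\<And>j. j < n \<Longrightarrow> degree (p j) < n"
  shows "det (mat n n (\<lambda>(i, j). poly (p j) (y i))) =
    (\<Prod>i<n. \<Prod>m<i. y i - y m) * det (mat n n (\<lambda>(i, j). coeff (p j) i))"
proof -
  define N where "N r = (\<Prod>m<r. [:- y m, 1:])" for r
  have deg: "degree (N r) = r" for r
    unfolding N_def by (subst degree_prod_eq_sum_degree) auto
  have monic: "coeff (N r) r = 1" for r
  proof -
    have "lead_coeff (N r) = 1"
      unfolding N_def by (simp add: lead_coeff_prod)
    then show ?thesis
      by (simp add: deg)
  qed
  have ev: "poly (N r) (y i) = (\<Prod>m<r. y i - y m)" for r i
    unfolding N_def by (simp add: poly_prod)
  let ?V = "det (mat n n (\<lambda>(i, k). y i ^ k))"
  have mult: "det (mat n n (\<lambda>(i, j). poly (f j) (y i))) =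
      ?V * det (mat n n (\<lambda>(i, j). coeff (f j) i))"
    if "\<And>j. j < n \<Longrightarrow> degree (f j) < n" for f
    unfolding det_mult_mat[symmetric] by (intro det_mat_cong poly_eq_sum_coeff that)
  have "?V = ?V * det (mat n n (\<lambda>(i, j). coeff (N j) i))"
    by (subst det_unitriangular) (auto simp: monic coeff_eq_0 deg)
  also have "\<dots> = det (mat n n (\<lambda>(i, j). poly (N j) (y i)))"
    by (rule mult[symmetric]) (simp add: deg)
  also have "\<dots> = det (mat n n (\<lambda>(i, j). \<Prod>m<j. y i - y m))"
    by (simp add: ev)
  also have "\<dots> = (\<Prod>i<n. \<Prod>m<i. y i - y m)"
  proof -
    let ?A = "mat n n (\<lambda>(i, j). \<Prod>m<j. y i - y m)"
    have "det ?A = prod_list (diag_mat ?A)"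
      by (rule det_lower_triangular[where n = n]) auto
    also have "diag_mat ?A = map (\<lambda>i. \<Prod>m<i. y i - y m) [0..<n]"
      by (auto simp: diag_mat_def)
    also have "prod_list \<dots> = (\<Prod>i<n. \<Prod>m<i. y i - y m)"
      by (simp add: prod.list_conv_set_nth atLeast0LessThan)
    finally show ?thesis .
  qed
  finally show ?thesis
    using mult[OF assms] by simp
qed

section \<open>Removing the ones of a plane overpartition\<close>

text \<open>Such a set is \<open>{1..card S}\<close>. This serves both for locating the large
  entries of a row and for the height of a column.\<close>

lemma le_card_initial_segment:
  fixes S :: "nat set"
  assumes "finite S" "0 \<notin> S" "1 \<le> j"
    and closed: "\<And>j j'. j \<in> S \<Longrightarrow> 1 \<le> j' \<Longrightarrow> j' \<le> j \<Longrightarrow> j' \<in> S"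
  shows "j \<le> card S \<longleftrightarrow> j \<in> S"
proof
  assume "j \<in> S"
  then have "{1..j} \<subseteq> S"
    using closed by auto
  then have "card {1..j} \<le> card S"
    by (rule card_mono[OF \<open>finite S\<close>])
  then show "j \<le> card S"
    by simp
next
  assume le: "j \<le> card S"
  show "j \<in> S"
  proof (rule ccontr)
    assume "j \<notin> S"
    then have "x < j" if "x \<in> S" for x
      using closed[OF that \<open>1 \<le> j\<close>] by (meson not_less)
    moreover have "x \<noteq> 0" if "x \<in> S" for x
      using that \<open>0 \<notin> S\<close> by metis
    ultimately have "S \<subseteq> {1..<j}"
      by (auto simp: Suc_le_eq)
    then have "card S \<le> card {1..<j}"
      by (rule card_mono[rotated]) simp
    with le \<open>1 \<le> j\<close> show False
      by simp
  qed
qed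

text \<open>Shapes are functions on \<open>{1..n}\<close> that may take the value 0, so that the
  number of rows, and with it the size of the determinants, stays fixed when cells are
  removed.\<close>

definition diagram :: "nat \<Rightarrow> (nat \<Rightarrow> nat) \<Rightarrow> (nat \<times> nat) set" where
  "diagram n \<rho> = {(i, j). 1 \<le> i \<and> i \<le> n \<and> 1 \<le> j \<and> j \<le> \<rho> i}"

lemma mem_diagram [simp]:
  "(i, j) \<in> diagram n \<rho> \<longleftrightarrow> 1 \<le> i \<and> i \<le> n \<and> 1 \<le> j \<and> j \<le> \<rho> i"
  by (simp add: diagram_def)

lemma diagram_eq_Sigma: "diagram n \<rho> = Sigma {1..n} (\<lambda>i. {1..\<rho> i})"
  by (auto simp: diagram_def)

lemma finite_diagram [simp]: "finite (diagram n \<rho>)"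
  by (simp add: diagram_eq_Sigma)

lemma card_diagram: "card (diagram n \<rho>) = (\<Sum>i = 1..n. \<rho> i)"
  by (simp add: diagram_eq_Sigma card_SigmaI)

definition overpartition_fillings :: "(nat \<times> nat) set \<Rightarrow> filling set" where
  "overpartition_fillings D =
    {P \<in> D \<rightarrow>\<^sub>E {0<..} \<times> UNIV.
      (\<forall>i j j'. (i, j) \<in> D \<and> (i, j') \<in> D \<and> j < j' \<longrightarrow>
         entry P (i, j) \<ge> entry P (i, j')) \<and>
      (\<forall>i i' j. (i, j) \<in> D \<and> (i', j) \<in> D \<and> i < i' \<longrightarrow>
         entry P (i, j) \<ge> entry P (i', j)) \<and>
      (\<forall>i j j'. (i, j) \<in> D \<and> (i, j') \<in> D \<and> j < j' \<and>
         entry P (i, j) = entry P (i, j') \<longrightarrow> \<not> overlined P (i, j)) \<and>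
      (\<forall>i i' j. (i, j) \<in> D \<and> (i', j) \<in> D \<and> i < i' \<and>
         entry P (i, j) = entry P (i', j) \<longrightarrow> overlined P (i', j))}"

lemma overpartition_fillingsI:
  assumes "P \<in> D \<rightarrow>\<^sub>E {0<..} \<times> UNIV"
    and "\<And>i j j'. (i, j) \<in> D \<Longrightarrow> (i, j') \<in> D \<Longrightarrow> j < j' \<Longrightarrow> entry P (i, j) \<ge> entry P (i, j')"
    and "\<And>i i' j. (i, j) \<in> D \<Longrightarrow> (i', j) \<in> D \<Longrightarrow> i < i' \<Longrightarrow> entry P (i, j) \<ge> entry P (i', j)"
    and "\<And>i j j'. (i, j) \<in> D \<Longrightarrow> (i, j') \<in> D \<Longrightarrow> j < j' \<Longrightarrow>
      entry P (i, j) = entry P (i, j') \<Longrightarrow> \<not> overlined P (i, j)"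
    and "\<And>i i' j. (i, j) \<in> D \<Longrightarrow> (i', j) \<in> D \<Longrightarrow> i < i' \<Longrightarrow>
      entry P (i, j) = entry P (i', j) \<Longrightarrow> overlined P (i', j)"
  shows "P \<in> overpartition_fillings D"
  using assms unfolding overpartition_fillings_def by blast

lemma overpartition_fillingsD:
  assumes "P \<in> overpartition_fillings D"
  shows "P \<in> D \<rightarrow>\<^sub>E {0<..} \<times> UNIV"
    and "(i, j) \<in> D \<Longrightarrow> (i, j') \<in> D \<Longrightarrow> j < j' \<Longrightarrow> entry P (i, j) \<ge> entry P (i, j')"
    and "(i, j) \<in> D \<Longrightarrow> (i', j) \<in> D \<Longrightarrow> i < i' \<Longrightarrow> entry P (i, j) \<ge> entry P (i', j)"
    and "(i, j) \<in> D \<Longrightarrow> (i, j') \<in> D \<Longrightarrow> j < j' \<Longrightarrow>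
      entry P (i, j) = entry P (i, j') \<Longrightarrow> \<not> overlined P (i, j)"
    and "(i, j) \<in> D \<Longrightarrow> (i', j) \<in> D \<Longrightarrow> i < i' \<Longrightarrow>
      entry P (i, j) = entry P (i', j) \<Longrightarrow> overlined P (i', j)"
  using assms unfolding overpartition_fillings_def by blast+

lemma entry_pos: "P \<in> overpartition_fillings D \<Longrightarrow> c \<in> D \<Longrightarrow> entry P c > 0"
  using PiE_mem[OF overpartition_fillingsD(1)] by (fastforce simp: entry_def)

definition size_on :: "(nat \<times> nat) set \<Rightarrow> filling \<Rightarrow> nat" where
  "size_on D P = (\<Sum>c\<in>D. entry P c)"

definition overlined_on :: "(nat \<times> nat) set \<Rightarrow> filling \<Rightarrow> nat" where
  "overlined_on D P = card {c \<in> D. overlined P c}"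

definition fillings_of_size :: "(nat \<times> nat) set \<Rightarrow> nat \<Rightarrow> filling set" where
  "fillings_of_size D N = {P \<in> overpartition_fillings D. size_on D P = N}"

lemma finite_fillings_of_size:
  assumes "finite D"
  shows "finite (fillings_of_size D N)"
proof (rule finite_subset)
  show "fillings_of_size D N \<subseteq> D \<rightarrow>\<^sub>E {..N} \<times> UNIV"
  proof
    fix P assume P: "P \<in> fillings_of_size D N"
    then have "P \<in> D \<rightarrow>\<^sub>E {0<..} \<times> UNIV"
      unfolding fillings_of_size_def by (blast dest: overpartition_fillingsD(1))
    moreover have "entry P c \<le> N" if "c \<in> D" for c
      using P member_le_sum[OF that, of "entry P"] assms
      by (simp add: fillings_of_size_def size_on_def)
    ultimately show "P \<in> D \<rightarrow>\<^sub>E {..N} \<times> UNIV"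
      by (fastforce simp: PiE_iff entry_def mem_Times_iff)
  qed
qed (use assms in \<open>auto intro!: finite_PiE\<close>)

lemma size_on_ge_card:
  assumes "P \<in> overpartition_fillings D"
  shows "card D \<le> size_on D P"
proof -
  have "(\<Sum>c\<in>D. 1) \<le> (\<Sum>c\<in>D. entry P c)"
    by (rule sum_mono) (use entry_pos[OF assms] in \<open>fastforce simp: Suc_le_eq\<close>)
  then show ?thesis
    by (simp add: size_on_def)
qed

text \<open>The interlacing condition for horizontal strips: \<open>\<mu> i\<close> lies between
  consecutive parts of \<open>\<nu>\<close>, with 0 standing for the part after the last
  row.\<close>

abbreviation below :: "nat \<Rightarrow> (nat \<Rightarrow> nat) \<Rightarrow> nat \<Rightarrow> nat set" where
  "below n \<nu> i \<equiv> {(if i < n then \<nu> (Suc i) else 0)..\<nu> i}"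

text \<open>Here \<open>\<epsilon>\<close> marks the rows that lose their last cell. The bound
  \<open>\<epsilon> i \<le> \<rho> i\<close> makes the subtraction of natural numbers exact.\<close>

definition vstrips :: "nat \<Rightarrow> (nat \<Rightarrow> nat) \<Rightarrow> (nat \<Rightarrow> nat) set" where
  "vstrips n \<rho> = {\<epsilon> \<in> PiE {1..n} (\<lambda>_. {0, 1}).
     (\<forall>i\<in>{1..n}. \<epsilon> i \<le> \<rho> i) \<and> antimono_on {1..n} (\<lambda>i. \<rho> i - \<epsilon> i)}"

text \<open>Here \<open>\<epsilon> i = 1\<close> means that row \<open>i\<close> ends in an overlined one; the other ones of row \<open>i\<close> fill the
  columns after \<open>\<mu> i\<close> up to \<open>\<rho> i - \<epsilon> i\<close>.\<close>

definition add_ones :: "nat \<Rightarrow> (nat \<Rightarrow> nat) \<Rightarrow> (nat \<Rightarrow> nat) \<Rightarrow> (nat \<Rightarrow> nat) \<Rightarrow> filling \<Rightarrow> filling" where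
  "add_ones n \<rho> \<epsilon> \<mu> Q = (\<lambda>c\<in>diagram n \<rho>.
     if c \<in> diagram n \<mu> then (entry Q c + 1, overlined Q c)
     else (1, c \<notin> diagram n (\<lambda>i. \<rho> i - \<epsilon> i)))"

section \<open>From a filling to its ones and its larger entries\<close>

definition overlined_one :: "nat \<Rightarrow> (nat \<Rightarrow> nat) \<Rightarrow> filling \<Rightarrow> nat \<Rightarrow> nat" where
  "overlined_one n \<rho> P = (\<lambda>i\<in>{1..n}. if \<rho> i > 0 \<and> P (i, \<rho> i) = (1, True) then 1 else 0)"

definition large_part :: "nat \<Rightarrow> (nat \<Rightarrow> nat) \<Rightarrow> filling \<Rightarrow> nat \<Rightarrow> nat" where
  "large_part n \<rho> P = (\<lambda>i\<in>{1..n}. card {j. 1 \<le> j \<and> j \<le> \<rho> i \<and> entry P (i, j) \<ge> 2})"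

definition remove_ones :: "nat \<Rightarrow> (nat \<Rightarrow> nat) \<Rightarrow> filling \<Rightarrow> filling" where
  "remove_ones n \<rho> P =
     (\<lambda>c\<in>diagram n (large_part n \<rho> P). (entry P c - 1, overlined P c))"

lemma large_part_iff:
  assumes P: "P \<in> overpartition_fillings (diagram n \<rho>)" and i: "i \<in> {1..n}" and j: "1 \<le> j"
  shows "j \<le> large_part n \<rho> P i \<longleftrightarrow> j \<le> \<rho> i \<and> entry P (i, j) \<ge> 2"
proof -
  let ?S = "{j. 1 \<le> j \<and> j \<le> \<rho> i \<and> entry P (i, j) \<ge> 2}"
  have "j \<le> card ?S \<longleftrightarrow> j \<in> ?S"
  proof (rule le_card_initial_segment)
    show "finite ?S"
      by (rule finite_subset[of _ "{..\<rho> i}"]) auto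
    show "j' \<in> ?S" if "j \<in> ?S" "1 \<le> j'" "j' \<le> j" for j j'
      using overpartition_fillingsD(2)[OF P, of i j' j] that i by (cases "j' = j") auto
  qed (use j in auto)
  then show ?thesis
    using i j by (simp add: large_part_def)
qed

lemma overlined_one_iff:
  assumes P: "P \<in> overpartition_fillings (diagram n \<rho>)" and i: "i \<in> {1..n}" and j: "1 \<le> j"
  shows "j \<le> \<rho> i - overlined_one n \<rho> P i \<longleftrightarrow> j \<le> \<rho> i \<and> P (i, j) \<noteq> (1, True)"
proof -
  \<comment> \<open>Nothing stands to the right of an overlined one: a further entry would also be
    1, and only the last 1 of a row may be overlined.\<close>
  have "j = \<rho> i" if "j \<le> \<rho> i" "P (i, j) = (1, True)"
  proof (rule ccontr)
    assume "j \<noteq> \<rho> i"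
    with that have "j < \<rho> i"
      by simp
    moreover have "entry P (i, \<rho> i) \<le> entry P (i, j)" "entry P (i, \<rho> i) > 0"
      using overpartition_fillingsD(2)[OF P, of i j "\<rho> i"] entry_pos[OF P, of "(i, \<rho> i)"] i j
        \<open>j < \<rho> i\<close> by auto
    ultimately show False
      using overpartition_fillingsD(4)[OF P, of i j "\<rho> i"] i j that
      by (auto simp: entry_def overlined_def)
  qed
  moreover have "j \<le> \<rho> i - overlined_one n \<rho> P i \<longleftrightarrow> j \<le> \<rho> i" if "j \<noteq> \<rho> i"
    using that i j by (auto simp: overlined_one_def)
  ultimately show ?thesis
    using i j by (cases "j = \<rho> i") (auto simp: overlined_one_def)
qed

context
  fixes n :: nat and \<rho> :: "nat \<Rightarrow> nat"
  assumes dec: "antimono_on {1..n} \<rho>"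
begin

lemma rho_mono: "1 \<le> i \<Longrightarrow> i \<le> i' \<Longrightarrow> i' \<le> n \<Longrightarrow> \<rho> i' \<le> \<rho> i"
  using dec by (auto simp: monotone_on_def)

text \<open>Below an overlined one, each entry of the column is again 1, hence repeated, hence
  overlined. So removing the overlined ones leaves a partition.\<close>

lemma overlined_one_vstrip:
  assumes P: "P \<in> overpartition_fillings (diagram n \<rho>)"
  shows "overlined_one n \<rho> P \<in> vstrips n \<rho>"
proof -
  have "antimono_on {1..n} (\<lambda>i. \<rho> i - overlined_one n \<rho> P i)"
  proof (rule monotone_onI)
    fix i i' assume i: "i \<in> {1..n}" "i' \<in> {1..n}" "i \<le> i'"
    let ?j = "\<rho> i' - overlined_one n \<rho> P i'"
    show "?j \<le> \<rho> i - overlined_one n \<rho> P i"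
    proof (cases "?j = 0 \<or> i = i'")
      case False
      then have j: "1 \<le> ?j" "i < i'"
        using i by auto
      have le: "?j \<le> \<rho> i'" and ne: "P (i', ?j) \<noteq> (1, True)"
        using overlined_one_iff[OF P i(2) j(1)] by auto
      have le': "?j \<le> \<rho> i"
        using le rho_mono[of i i'] i by simp
      have "P (i, ?j) \<noteq> (1, True)"
      proof
        assume 1: "P (i, ?j) = (1, True)"
        have mem: "(i, ?j) \<in> diagram n \<rho>" "(i', ?j) \<in> diagram n \<rho>"
          using i j le le' by auto
        have "entry P (i', ?j) = entry P (i, ?j)"
          using overpartition_fillingsD(3)[OF P mem j(2)] entry_pos[OF P mem(2)] 1
          by (simp add: entry_def)
        then show False
          using overpartition_fillingsD(5)[OF P mem j(2)] ne 1
          by (simp add: entry_def overlined_def prod_eq_iff)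
      qed
      then show ?thesis
        using overlined_one_iff[OF P i(1) j(1)] le' by simp
    qed auto
  qed
  then show ?thesis
    unfolding vstrips_def by (auto simp: overlined_one_def)
qed

text \<open>A plain one cannot lie below another one, because a repeated entry of a column is
  overlined. Hence each column has at most one plain one, which is the interlacing
  condition.\<close>

lemma large_part_below:
  assumes P: "P \<in> overpartition_fillings (diagram n \<rho>)"
  shows "large_part n \<rho> P \<in> PiE {1..n} (below n (\<lambda>i. \<rho> i - overlined_one n \<rho> P i))"
proof (rule PiE_I)
  fix i assume i: "i \<in> {1..n}"
  let ?\<nu> = "\<lambda>i. \<rho> i - overlined_one n \<rho> P i" and ?\<mu> = "large_part n \<rho> P"
  have "?\<mu> i \<le> ?\<nu> i"
  proof (cases "?\<mu> i = 0")
    case False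
    then have j: "1 \<le> ?\<mu> i"
      by simp
    show ?thesis
      using large_part_iff[OF P i j] overlined_one_iff[OF P i j] by (auto simp: entry_def)
  qed simp
  moreover have "?\<nu> (Suc i) \<le> ?\<mu> i" if "i < n"
  proof (cases "?\<nu> (Suc i) = 0")
    case False
    let ?j = "?\<nu> (Suc i)"
    from False have j: "1 \<le> ?j"
      by simp
    have i': "Suc i \<in> {1..n}"
      using that by simp
    have le: "?j \<le> \<rho> (Suc i)" and ne: "P (Suc i, ?j) \<noteq> (1, True)"
      using overlined_one_iff[OF P i' j] by auto
    have le': "?j \<le> \<rho> i"
      using le rho_mono[of i "Suc i"] i i' by simp
    have mem: "(i, ?j) \<in> diagram n \<rho>" "(Suc i, ?j) \<in> diagram n \<rho>"
      using i i' j le le' by auto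
    have "entry P (i, ?j) \<ge> 2"
    proof (rule ccontr)
      assume "\<not> entry P (i, ?j) \<ge> 2"
      then have "entry P (i, ?j) = 1" "entry P (Suc i, ?j) = 1"
        using overpartition_fillingsD(3)[OF P mem] entry_pos[OF P mem(1)] entry_pos[OF P mem(2)]
        by auto
      then show False
        using overpartition_fillingsD(5)[OF P mem] ne by (simp add: entry_def overlined_def prod_eq_iff)
    qed
    then show ?thesis
      using large_part_iff[OF P i j] le' by simp
  qed simp
  ultimately show "?\<mu> i \<in> below n ?\<nu> i"
    by auto
qed (auto simp: large_part_def)

lemma diagram_large_part_subset:
  assumes "P \<in> overpartition_fillings (diagram n \<rho>)"
  shows "diagram n (large_part n \<rho> P) = {c \<in> diagram n \<rho>. entry P c \<ge> 2}"
  using large_part_iff[OF assms] by auto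

lemma remove_ones_filling:
  assumes P: "P \<in> overpartition_fillings (diagram n \<rho>)"
  shows "remove_ones n \<rho> P \<in> overpartition_fillings (diagram n (large_part n \<rho> P))"
    (is "?Q \<in> overpartition_fillings ?D")
proof -
  have D: "c \<in> diagram n \<rho>" "entry P c \<ge> 2" "entry ?Q c = entry P c - 1"
    "overlined ?Q c = overlined P c" if "c \<in> ?D" for c
    using that by (auto simp: diagram_large_part_subset[OF P] remove_ones_def entry_def overlined_def)
  show ?thesis
  proof (rule overpartition_fillingsI)
    show "?Q \<in> ?D \<rightarrow>\<^sub>E {0<..} \<times> UNIV"
      using D(2) by (fastforce simp: remove_ones_def)
  next
    fix i j j' assume *: "(i, j) \<in> ?D" "(i, j') \<in> ?D" "j < j'"
    then show "entry ?Q (i, j) \<ge> entry ?Q (i, j')"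
      using overpartition_fillingsD(2)[OF P D(1)[OF *(1)] D(1)[OF *(2)]] D(3)[OF *(1)] D(3)[OF *(2)]
      by (simp add: diff_le_mono)
    assume "entry ?Q (i, j) = entry ?Q (i, j')"
    then have "entry P (i, j) = entry P (i, j')"
      using D(2)[OF *(1)] D(2)[OF *(2)] D(3)[OF *(1)] D(3)[OF *(2)] by simp
    then show "\<not> overlined ?Q (i, j)"
      using overpartition_fillingsD(4)[OF P D(1)[OF *(1)] D(1)[OF *(2)] *(3)] D(4)[OF *(1)] by simp
  next
    fix i i' j assume *: "(i, j) \<in> ?D" "(i', j) \<in> ?D" "i < i'"
    then show "entry ?Q (i, j) \<ge> entry ?Q (i', j)"
      using overpartition_fillingsD(3)[OF P D(1)[OF *(1)] D(1)[OF *(2)]] D(3)[OF *(1)] D(3)[OF *(2)]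
      by (simp add: diff_le_mono)
    assume "entry ?Q (i, j) = entry ?Q (i', j)"
    then have "entry P (i, j) = entry P (i', j)"
      using D(2)[OF *(1)] D(2)[OF *(2)] D(3)[OF *(1)] D(3)[OF *(2)] by simp
    then show "overlined ?Q (i', j)"
      using overpartition_fillingsD(5)[OF P D(1)[OF *(1)] D(1)[OF *(2)] *(3)] D(4)[OF *(2)] by simp
  qed
qed

lemma add_remove_ones:
  assumes P: "P \<in> overpartition_fillings (diagram n \<rho>)"
  shows "add_ones n \<rho> (overlined_one n \<rho> P) (large_part n \<rho> P) (remove_ones n \<rho> P) = P"
    (is "?P' = P")
proof
  fix c :: "nat \<times> nat"
  obtain i j where c: "c = (i, j)"
    by fastforce
  show "?P' c = P c"
  proof (cases "c \<in> diagram n \<rho>")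
    case False
    then show ?thesis
      using overpartition_fillingsD(1)[OF P] by (simp add: add_ones_def PiE_arb[of P])
  next
    case mem: True
    then have i: "i \<in> {1..n}" and j: "1 \<le> j" and le: "j \<le> \<rho> i"
      by (auto simp: c)
    have pos: "fst (P c) > 0"
      using entry_pos[OF P mem] by (simp add: entry_def)
    show ?thesis
      using large_part_iff[OF P i j] overlined_one_iff[OF P i j] i j le pos mem
      by (cases "P c") (auto simp: c add_ones_def remove_ones_def entry_def overlined_def)
  qed
qed

section \<open>From a pair of strips back to a filling\<close>

context
  fixes \<epsilon> \<mu> :: "nat \<Rightarrow> nat"
  assumes \<epsilon>: "\<epsilon> \<in> vstrips n \<rho>" and \<mu>: "\<mu> \<in> PiE {1..n} (below n (\<lambda>i. \<rho> i - \<epsilon> i))"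
begin

lemma eps_le: "i \<in> {1..n} \<Longrightarrow> \<epsilon> i \<le> 1" "i \<in> {1..n} \<Longrightarrow> \<epsilon> i \<le> \<rho> i"
  using \<epsilon> by (force simp: vstrips_def PiE_iff)+

lemma mu_le: "i \<in> {1..n} \<Longrightarrow> \<mu> i \<le> \<rho> i - \<epsilon> i"
  using PiE_mem[OF \<mu>, of i] by auto

text \<open>Interlacing with the next row extends to all later rows, since
  \<open>\<rho> i - \<epsilon> i\<close> decreases weakly. It keeps two new plain ones out of the
  same column.\<close>

lemma mu_ge: "1 \<le> i \<Longrightarrow> i < i' \<Longrightarrow> i' \<le> n \<Longrightarrow> \<rho> i' - \<epsilon> i' \<le> \<mu> i"
proof -
  assume i: "1 \<le> i" "i < i'" "i' \<le> n"
  then have "\<rho> i' - \<epsilon> i' \<le> \<rho> (Suc i) - \<epsilon> (Suc i)"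
    using \<epsilon> by (auto simp: vstrips_def monotone_on_def)
  also have "\<dots> \<le> \<mu> i"
    using PiE_mem[OF \<mu>, of i] i by auto
  finally show ?thesis .
qed

lemma mu_antimono: "antimono_on {1..n} \<mu>"
proof (rule monotone_onI)
  fix i i' assume i: "i \<in> {1..n}" "i' \<in> {1..n}" "i \<le> i'"
  then show "\<mu> i' \<le> \<mu> i"
    using mu_ge[of i i'] mu_le[of i'] by (cases "i = i'") auto
qed

lemma diagram_mu_subset: "diagram n \<mu> \<subseteq> diagram n \<rho>"
  using mu_le by fastforce

context
  fixes Q :: filling
  assumes Q: "Q \<in> overpartition_fillings (diagram n \<mu>)"
begin

abbreviation (input) "plus_ones \<equiv> add_ones n \<rho> \<epsilon> \<mu> Q"

lemma entry_add_ones: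
  "c \<in> diagram n \<rho> \<Longrightarrow> entry plus_ones c = (if c \<in> diagram n \<mu> then entry Q c + 1 else 1)"
  by (simp add: add_ones_def entry_def)

lemma overlined_add_ones:
  "c \<in> diagram n \<rho> \<Longrightarrow>
    overlined plus_ones c = (if c \<in> diagram n \<mu> then overlined Q c else c \<notin> diagram n (\<lambda>i. \<rho> i - \<epsilon> i))"
  by (simp add: add_ones_def overlined_def)

lemma add_ones_filling: "plus_ones \<in> overpartition_fillings (diagram n \<rho>)"
proof (rule overpartition_fillingsI)
  show "plus_ones \<in> diagram n \<rho> \<rightarrow>\<^sub>E {0<..} \<times> UNIV"
    by (auto simp: add_ones_def)
next
  fix i j j' assume *: "(i, j) \<in> diagram n \<rho>" "(i, j') \<in> diagram n \<rho>" "j < j'"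
  show "entry plus_ones (i, j) \<ge> entry plus_ones (i, j')"
    using overpartition_fillingsD(2)[OF Q, of i j j'] * by (simp add: entry_add_ones)
  assume eq: "entry plus_ones (i, j) = entry plus_ones (i, j')"
  show "\<not> overlined plus_ones (i, j)"
  proof (cases "(i, j') \<in> diagram n \<mu>")
    case True
    then show ?thesis
      using overpartition_fillingsD(4)[OF Q, of i j j'] * eq
      by (simp add: entry_add_ones overlined_add_ones)
  next
    case False
    \<comment> \<open>Cells of \<open>\<mu>\<close> now hold at least 2, so an entry equal to a new
      1 lies outside \<open>\<mu>\<close> as well.\<close>
    then have "(i, j) \<notin> diagram n \<mu>"
      using eq entry_pos[OF Q, of "(i, j)"] *(1,2) by (auto simp: entry_add_ones simp del: mem_diagram)
    moreover have "j \<le> \<rho> i - \<epsilon> i"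
      using * eps_le(1)[of i] by auto
    ultimately show ?thesis
      using * by (simp add: overlined_add_ones)
  qed
next
  fix i i' j assume *: "(i, j) \<in> diagram n \<rho>" "(i', j) \<in> diagram n \<rho>" "i < i'"
  have mu: "\<mu> i' \<le> \<mu> i"
    using mu_antimono * by (auto simp: monotone_on_def)
  then show "entry plus_ones (i, j) \<ge> entry plus_ones (i', j)"
    using overpartition_fillingsD(3)[OF Q, of i j i'] * by (simp add: entry_add_ones)
  assume eq: "entry plus_ones (i, j) = entry plus_ones (i', j)"
  show "overlined plus_ones (i', j)"
  proof (cases "(i', j) \<in> diagram n \<mu>")
    case True
    then show ?thesis
      using overpartition_fillingsD(5)[OF Q, of i j i'] * eq mu
      by (simp add: entry_add_ones overlined_add_ones)
  next
    case False
    then have "(i, j) \<notin> diagram n \<mu>"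
      using eq entry_pos[OF Q, of "(i, j)"] *(1,2) by (auto simp: entry_add_ones simp del: mem_diagram)
    \<comment> \<open>The upper cell lies beyond \<open>\<mu> i\<close>, hence \<open>j\<close> lies
      beyond the shortened row \<open>i'\<close>, where the new ones are overlined.\<close>
    then have "\<not> j \<le> \<rho> i' - \<epsilon> i'"
      using mu_ge[of i i'] * by auto
    then show ?thesis
      using * False by (simp add: overlined_add_ones)
  qed
qed

text \<open>If \<open>\<epsilon> i = 1\<close>, the last cell of the row lies beyond
  \<open>\<mu> i\<close> and receives an overlined one; otherwise the last cell, if there is one,
  holds a plain one or at least 2.\<close>

lemma overlined_one_add_ones: "overlined_one n \<rho> plus_ones = \<epsilon>"
proof (rule extensionalityI[of _ "{1..n}"])
  show "\<epsilon> \<in> extensional {1..n}"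
    using \<epsilon> by (auto simp: vstrips_def PiE_iff)
next
  fix i assume i: "i \<in> {1..n}"
  have "plus_ones (i, \<rho> i) = (1, True) \<longleftrightarrow> \<epsilon> i = 1" if "\<rho> i > 0"
  proof -
    have mem: "(i, \<rho> i) \<in> diagram n \<rho>"
      using i that by simp
    have "(i, \<rho> i) \<notin> diagram n \<mu>" if "\<epsilon> i = 1"
      using mu_le[OF i] that \<open>\<rho> i > 0\<close> by auto
    moreover have "entry plus_ones (i, \<rho> i) > 1" if "(i, \<rho> i) \<in> diagram n \<mu>"
      using that mem entry_pos[OF Q that] by (simp add: entry_add_ones del: mem_diagram)
    moreover have "\<epsilon> i = 0 \<or> \<epsilon> i = 1"
      using eps_le(1)[OF i] by auto
    ultimately show ?thesis
      using i that mem by (auto simp: add_ones_def entry_def)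
  qed
  then show "overlined_one n \<rho> plus_ones i = \<epsilon> i"
    using i eps_le[OF i] by (cases "\<rho> i = 0") (auto simp: overlined_one_def le_Suc_eq)
qed (simp add: overlined_one_def)

lemma large_part_add_ones: "large_part n \<rho> plus_ones = \<mu>"
proof (rule extensionalityI[of _ "{1..n}"])
  fix i assume i: "i \<in> {1..n}"
  have "{j. 1 \<le> j \<and> j \<le> \<rho> i \<and> entry plus_ones (i, j) \<ge> 2} = {1..\<mu> i}"
    using mu_le[OF i] i entry_pos[OF Q, of "(i, _)"] by (force simp: entry_add_ones split: if_splits)
  then show "large_part n \<rho> plus_ones i = \<mu> i"
    using i by (simp add: large_part_def)
qed (use \<mu> in \<open>auto simp: large_part_def PiE_iff\<close>)

lemma remove_add_ones: "remove_ones n \<rho> plus_ones = Q"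
proof
  fix c
  show "remove_ones n \<rho> plus_ones c = Q c"
    using diagram_mu_subset PiE_arb[OF overpartition_fillingsD(1)[OF Q], of c]
    unfolding remove_ones_def large_part_add_ones
    by (auto simp: entry_add_ones overlined_add_ones entry_def[of Q] overlined_def[of Q]
        simp del: mem_diagram)
qed

lemma size_add_ones: "size_on (diagram n \<rho>) plus_ones = size_on (diagram n \<mu>) Q + (\<Sum>i = 1..n. \<rho> i)"
proof -
  have "size_on (diagram n \<rho>) plus_ones =
      (\<Sum>c\<in>diagram n \<rho>. (if c \<in> diagram n \<mu> then entry Q c else 0) + 1)"
    unfolding size_on_def by (rule sum.cong) (simp_all add: entry_add_ones del: mem_diagram)
  also have "\<dots> = (\<Sum>c\<in>diagram n \<rho> \<inter> diagram n \<mu>. entry Q c) + card (diagram n \<rho>)"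
    by (simp only: sum.distrib) (simp add: sum.inter_restrict del: mem_diagram)
  finally show ?thesis
    using diagram_mu_subset by (simp add: size_on_def card_diagram Int_absorb1)
qed

text \<open>The overlines of \<open>Q\<close> are kept, and the new ones sit on the cells cut off by
  \<open>\<epsilon>\<close>, one in each marked row.\<close>

lemma overlined_add_ones_count:
  "overlined_on (diagram n \<rho>) plus_ones = overlined_on (diagram n \<mu>) Q + (\<Sum>i = 1..n. \<epsilon> i)"
proof -
  let ?\<nu> = "\<lambda>i. \<rho> i - \<epsilon> i"
  have sub: "diagram n \<mu> \<subseteq> diagram n ?\<nu>" "diagram n ?\<nu> \<subseteq> diagram n \<rho>"
    using mu_le by fastforce+
  have "{c \<in> diagram n \<rho>. overlined plus_ones c} =
      {c \<in> diagram n \<mu>. overlined Q c} \<union> (diagram n \<rho> - diagram n ?\<nu>)"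
    using sub by (auto simp: overlined_add_ones simp del: mem_diagram split: if_splits)
  moreover have "card (diagram n \<rho> - diagram n ?\<nu>) = (\<Sum>i = 1..n. \<epsilon> i)"
  proof -
    have "card (diagram n \<rho> - diagram n ?\<nu>) = (\<Sum>i = 1..n. \<rho> i) - (\<Sum>i = 1..n. \<rho> i - \<epsilon> i)"
      using sub by (simp add: card_Diff_subset card_diagram)
    also have "(\<Sum>i = 1..n. \<rho> i) = (\<Sum>i = 1..n. \<rho> i - \<epsilon> i) + (\<Sum>i = 1..n. \<epsilon> i)"
      unfolding sum.distrib[symmetric] by (rule sum.cong) (use eps_le(2) in auto)
    finally show ?thesis
      by simp
  qed
  moreover have "card ({c \<in> diagram n \<mu>. overlined Q c} \<union> (diagram n \<rho> - diagram n ?\<nu>)) =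
      card {c \<in> diagram n \<mu>. overlined Q c} + card (diagram n \<rho> - diagram n ?\<nu>)"
    by (rule card_Un_disjoint) (use sub in \<open>auto simp del: mem_diagram\<close>)
  ultimately show ?thesis
    by (simp add: overlined_on_def)
qed

end

end

end

section \<open>The recursion for the coefficients of the generating function\<close>

definition weight_sum :: "'k :: comm_ring_1 \<Rightarrow> nat \<Rightarrow> (nat \<Rightarrow> nat) \<Rightarrow> nat \<Rightarrow> 'k" where
  "weight_sum z n \<rho> N = (\<Sum>P\<in>fillings_of_size (diagram n \<rho>) N. z ^ overlined_on (diagram n \<rho>) P)"

lemma weight_sum_small:
  assumes "N < (\<Sum>i = 1..n. \<rho> i)"
  shows "weight_sum z n \<rho> N = 0"
proof -
  have "fillings_of_size (diagram n \<rho>) N = {}"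
    using size_on_ge_card[of _ "diagram n \<rho>"] assms
    by (fastforce simp: fillings_of_size_def card_diagram)
  then show ?thesis
    by (simp add: weight_sum_def)
qed

lemma finite_vstrips: "finite (vstrips n \<rho>)"
  by (rule finite_subset[of _ "PiE {1..n} (\<lambda>_. {0, 1})"]) (auto simp: vstrips_def intro!: finite_PiE)

text \<open>Splitting off the ones is a bijection between fillings \<open>P\<close> and triples of a
  vertical strip, a horizontal strip and a filling \<open>Q\<close> of what remains. It takes one
  unit of size from each cell of \<open>\<rho>\<close> and one overline from each cell of the
  vertical strip.\<close>

lemma weight_sum_rec:
  assumes dec: "antimono_on {1..n} \<rho>"
  shows "weight_sum z n \<rho> (N + (\<Sum>i = 1..n. \<rho> i)) =
    (\<Sum>\<epsilon>\<in>vstrips n \<rho>. z ^ (\<Sum>i = 1..n. \<epsilon> i) *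
      (\<Sum>\<mu>\<in>PiE {1..n} (below n (\<lambda>i. \<rho> i - \<epsilon> i)). weight_sum z n \<mu> N))"
proof -
  let ?S = "SIGMA \<epsilon>:vstrips n \<rho>. SIGMA \<mu>:PiE {1..n} (below n (\<lambda>i. \<rho> i - \<epsilon> i)).
    fillings_of_size (diagram n \<mu>) N"
  have "weight_sum z n \<rho> (N + (\<Sum>i = 1..n. \<rho> i)) =
      (\<Sum>(\<epsilon>, \<mu>, Q)\<in>?S. z ^ (\<Sum>i = 1..n. \<epsilon> i) * z ^ overlined_on (diagram n \<mu>) Q)"
    unfolding weight_sum_def
  proof (rule sum.reindex_bij_witness[of _ "\<lambda>(\<epsilon>, \<mu>, Q). add_ones n \<rho> \<epsilon> \<mu> Q"
        "\<lambda>P. (overlined_one n \<rho> P, large_part n \<rho> P, remove_ones n \<rho> P)"])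
    fix P assume "P \<in> fillings_of_size (diagram n \<rho>) (N + (\<Sum>i = 1..n. \<rho> i))"
    then have P: "P \<in> overpartition_fillings (diagram n \<rho>)"
      and size: "size_on (diagram n \<rho>) P = N + (\<Sum>i = 1..n. \<rho> i)"
      by (auto simp: fillings_of_size_def)
    note mem = overlined_one_vstrip[OF dec P] large_part_below[OF dec P]
      remove_ones_filling[OF dec P]
    have P': "add_ones n \<rho> (overlined_one n \<rho> P) (large_part n \<rho> P) (remove_ones n \<rho> P) = P"
      by (rule add_remove_ones[OF dec P])
    show "(case (overlined_one n \<rho> P, large_part n \<rho> P, remove_ones n \<rho> P) of
        (\<epsilon>, \<mu>, Q) \<Rightarrow> add_ones n \<rho> \<epsilon> \<mu> Q) = P"
      by (simp add: P')
    have "size_on (diagram n (large_part n \<rho> P)) (remove_ones n \<rho> P) = N"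
      using size_add_ones[OF dec mem] size by (simp add: P')
    then show "(overlined_one n \<rho> P, large_part n \<rho> P, remove_ones n \<rho> P) \<in> ?S"
      using mem by (simp add: fillings_of_size_def)
    show "(case (overlined_one n \<rho> P, large_part n \<rho> P, remove_ones n \<rho> P) of
        (\<epsilon>, \<mu>, Q) \<Rightarrow> z ^ (\<Sum>i = 1..n. \<epsilon> i) * z ^ overlined_on (diagram n \<mu>) Q) =
        z ^ overlined_on (diagram n \<rho>) P"
      using overlined_add_ones_count[OF dec mem] by (simp add: P' power_add)
  next
    fix x assume "x \<in> ?S"
    then obtain \<epsilon> \<mu> Q where x: "x = (\<epsilon>, \<mu>, Q)" and mem: "\<epsilon> \<in> vstrips n \<rho>"
      "\<mu> \<in> PiE {1..n} (below n (\<lambda>i. \<rho> i - \<epsilon> i))" "Q \<in> overpartition_fillings (diagram n \<mu>)"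
      and size: "size_on (diagram n \<mu>) Q = N"
      by (auto simp: fillings_of_size_def)
    show "(\<lambda>P. (overlined_one n \<rho> P, large_part n \<rho> P, remove_ones n \<rho> P))
        (case x of (\<epsilon>, \<mu>, Q) \<Rightarrow> add_ones n \<rho> \<epsilon> \<mu> Q) = x"
      by (simp add: x overlined_one_add_ones[OF dec mem] large_part_add_ones[OF dec mem]
          remove_add_ones[OF dec mem])
    show "(case x of (\<epsilon>, \<mu>, Q) \<Rightarrow> add_ones n \<rho> \<epsilon> \<mu> Q)
        \<in> fillings_of_size (diagram n \<rho>) (N + (\<Sum>i = 1..n. \<rho> i))"
      by (simp add: x fillings_of_size_def add_ones_filling[OF dec mem] size_add_ones[OF dec mem]
          size)
  qed
  also have "\<dots> = (\<Sum>\<epsilon>\<in>vstrips n \<rho>.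
      \<Sum>\<mu>\<in>PiE {1..n} (below n (\<lambda>i. \<rho> i - \<epsilon> i)). \<Sum>Q\<in>fillings_of_size (diagram n \<mu>) N.
        z ^ (\<Sum>i = 1..n. \<epsilon> i) * z ^ overlined_on (diagram n \<mu>) Q)"
    by (simp add: sum.Sigma finite_vstrips finite_PiE finite_fillings_of_size finite_SigmaI)
  finally show ?thesis
    by (simp add: weight_sum_def sum_distrib_left)
qed

section \<open>The recursion for the Jacobi-Trudi determinant\<close>

text \<open>Keeps all denominators away from 0. The last assumption covers all integer exponents,
  because the factors in the denominator of \<open>phi\<close> can have negative ones.\<close>

locale q_params =
  fixes a q :: "'a :: field"
  assumes q_nz: "q \<noteq> 0"
    and q_pow_neq_1: "\<And>k. k > 0 \<Longrightarrow> q ^ k \<noteq> 1"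
    and one_plus_nz: "\<And>k :: int. 1 + a * q powi k \<noteq> 0"
begin

section \<open>One-row series and their q-recursions\<close>

definition g :: "int \<Rightarrow> 'a" where
  "g m = (if m < 0 then 0 else \<Prod>i = 1..nat m. (1 + a * q ^ i) / (1 - q ^ i))"

text \<open>For \<open>m \<ge> 0\<close>, \<open>h m\<close> is the generating function of a single
  row of length \<open>m\<close>, and \<open>g m\<close> is the sum of \<open>h 0\<close> up to
  \<open>h m\<close>.\<close>

definition h :: "int \<Rightarrow> 'a" where
  "h m = g m - g (m - 1)"

lemma g_neg: "m < 0 \<Longrightarrow> g m = 0"
  by (simp add: g_def)

lemma h_neg: "m < 0 \<Longrightarrow> h m = 0"
  by (simp add: h_def g_neg)

lemma g_0 [simp]: "g 0 = 1"
  by (simp add: g_def)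

lemma h_0 [simp]: "h 0 = 1"
  by (simp add: h_def g_neg)

lemma one_minus_nz: "k > 0 \<Longrightarrow> 1 - q ^ k \<noteq> 0"
  using q_pow_neq_1[of k] by simp

lemma g_Suc: "g (int (Suc k)) * (1 - q ^ Suc k) = (1 + a * q ^ Suc k) * g (int k)"
  using one_minus_nz[of "Suc k"]
  by (simp add: g_def nat_add_distrib del: power_Suc of_nat_Suc)

lemma h_Suc: "h (int (Suc k)) * (1 - q ^ Suc k) = (1 + a) * q ^ Suc k * g (int k)"
proof -
  have "h (int (Suc k)) * (1 - q ^ Suc k) =
      g (int (Suc k)) * (1 - q ^ Suc k) - g (int k) * (1 - q ^ Suc k)"
    by (simp add: h_def algebra_simps)
  then show ?thesis
    unfolding g_Suc by (simp add: algebra_simps)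
qed

lemma h_eq_g: "h m = q powi m * (g m + a * g (m - 1))"
proof (cases "m \<le> 0")
  case True
  then show ?thesis
    by (cases "m = 0") (simp_all add: h_neg g_neg)
next
  case False
  then obtain k where m: "m = int (Suc k)"
    by (metis Suc_pred' nat_0_less_mult_iff not_le pos_int_cases zero_less_nat_eq nat_int)
  have m1: "m - 1 = int k"
    by (simp add: m)
  \<comment> \<open>With the denominator of \<open>g (int (Suc k))\<close> cleared, this becomes
    \<open>(1 + a) * q ^ Suc k * g (int k)\<close>, since
    \<open>(1 + a * x) + a * (1 - x) = 1 + a\<close>.\<close>
  have "(q ^ Suc k * (g (int (Suc k)) + a * g (int k))) * (1 - q ^ Suc k) =
      q ^ Suc k * ((1 + a * q ^ Suc k) * g (int k) + a * g (int k) * (1 - q ^ Suc k))"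
    by (simp only: g_Suc[symmetric]) (simp add: algebra_simps)
  also have "\<dots> = (1 + a) * q ^ Suc k * g (int k)"
    by (simp add: algebra_simps)
  finally have "h m * (1 - q ^ Suc k) = (q powi m * (g m + a * g (m - 1))) * (1 - q ^ Suc k)"
    unfolding m1 unfolding m h_Suc power_int_of_nat by (rule sym)
  then show ?thesis
    by (subst (asm) mult_right_cancel) (use one_minus_nz[of "Suc k"] in auto)
qed

text \<open>The quotient of consecutive values, written without denominators so that it holds for
  every integer: at \<open>m = - 1\<close> the factor \<open>1 - q powi 0\<close> vanishes.\<close>

lemma h_rec: "h (m + 1) * (1 - q powi (m + 1)) = q * (1 + a * q powi m) * h m"
proof (cases "m < 0")
  case True
  then show ?thesis
    by (cases "m = - 1") (simp_all add: h_neg)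
next
  case False
  then obtain k where m: "m = int k"
    by (metis not_le nonneg_int_cases linorder_not_less)
  have *: "h (int (Suc k)) * (1 - q ^ Suc k) = q * (1 + a * q ^ k) * h (int k)"
  proof (cases k)
    case 0
    then show ?thesis
      unfolding h_Suc by simp
  next
    case (Suc l)
    have "(q * (1 + a * q ^ k) * h (int k)) * (1 - q ^ k) =
        q * (1 + a * q ^ k) * ((1 + a) * q ^ k * g (int l))"
      using h_Suc[of l] by (simp add: Suc mult.assoc del: power_Suc of_nat_Suc)
    also have "\<dots> = (1 + a) * q ^ Suc k * ((1 + a * q ^ k) * g (int l))"
      by (simp add: mult_ac)
    also have "\<dots> = (1 + a) * q ^ Suc k * g (int k) * (1 - q ^ k)"
      using g_Suc[of l] by (simp add: Suc mult.assoc del: power_Suc of_nat_Suc)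
    finally have "q * (1 + a * q ^ k) * h (int k) = (1 + a) * q ^ Suc k * g (int k)"
      by (subst (asm) mult_right_cancel) (use one_minus_nz[of k] Suc in auto)
    then show ?thesis
      by (simp only: h_Suc)
  qed
  have "q powi (int k + 1) = q ^ Suc k"
    using power_int_of_nat[of q "Suc k"] by (simp add: add.commute)
  with * show ?thesis
    unfolding m by (simp add: add.commute)
qed

section \<open>Jacobi-Trudi determinants and strips\<close>

definition J :: "nat \<Rightarrow> (nat \<Rightarrow> nat) \<Rightarrow> 'a" where
  "J n \<rho> = det (mat n n (\<lambda>(i, j). h (int (\<rho> (Suc i)) - int i + int j)))"

text \<open>The argument is integer valued because
  \<open>int (\<rho> i) - int (\<epsilon> i)\<close> can be -1 until the invalid choices of
  \<open>\<epsilon>\<close> are discarded.\<close>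

definition G :: "nat \<Rightarrow> (nat \<Rightarrow> int) \<Rightarrow> 'a" where
  "G n \<nu> = det (mat n n (\<lambda>(i, j). g (\<nu> (Suc i) - int i + int j)))"

text \<open>The sum telescopes. The bound \<open>u \<le> v + 1\<close> admits the empty sum, for
  which the right side is 0 too.\<close>

lemma sum_h: "u \<le> v + 1 \<Longrightarrow> (\<Sum>m = u..v. h (int m + c)) = g (int v + c) - g (int u - 1 + c)"
proof (induction v)
  case 0
  then show ?case
    by (cases "u = 0") (auto simp: h_def le_Suc_eq)
next
  case (Suc v)
  show ?case
  proof (cases "u = Suc v + 1")
    case False
    with Suc have "u \<le> Suc v" "(\<Sum>m = u..v. h (int m + c)) = g (int v + c) - g (int u - 1 + c)"
      by auto
    then show ?thesis
      by (simp add: h_def algebra_simps)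
  qed simp
qed

text \<open>Because of the shift by \<open>i\<close>, consecutive rows differ by one telescoping sum
  of \<open>h\<close> over the interlacing range; multilinearity turns choices of summands into
  horizontal strips. The added row \<open>n\<close> of \<open>?F\<close> has part 0, so its
  arguments of \<open>g\<close> are negative and it vanishes.\<close>

lemma G_eq_sum_J:
  assumes "antimono_on {1..n} \<nu>"
  shows "G n (\<lambda>i. int (\<nu> i)) = (\<Sum>\<mu>\<in>PiE {1..n} (below n \<nu>). J n \<mu>)"
proof -
  let ?F = "\<lambda>i j. g ((if i < n then int (\<nu> (Suc i)) else 0) - int i + int j)"
  have "G n (\<lambda>i. int (\<nu> i)) = det (mat n n (\<lambda>(i, j). ?F i j))"
    unfolding G_def by (rule det_mat_cong) simp
  also have "\<dots> = det (mat n n (\<lambda>(i, j). ?F i j - ?F (Suc i) j))"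
    by (rule det_diff_rows[symmetric]) (simp add: g_neg)
  also have "\<dots> = det (mat n n (\<lambda>(i, j). \<Sum>m\<in>below n \<nu> (Suc i). h (int m - int i + int j)))"
  proof (rule det_mat_cong)
    fix i j assume ij: "i < n" "j < n"
    let ?u = "if Suc i < n then \<nu> (Suc (Suc i)) else 0"
    have "?u \<le> \<nu> (Suc i)"
      using ij assms by (auto simp: monotone_on_def)
    then have "?u \<le> \<nu> (Suc i) + 1"
      by simp
    then have "(\<Sum>m = ?u..\<nu> (Suc i). h (int m + (int j - int i))) =
        g (int (\<nu> (Suc i)) + (int j - int i)) - g (int ?u - 1 + (int j - int i))"
      by (rule sum_h)
    then show "?F i j - ?F (Suc i) j = (\<Sum>m\<in>below n \<nu> (Suc i). h (int m - int i + int j))"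
      using ij by (auto simp: algebra_simps)
  qed
  also have "\<dots> = (\<Sum>\<mu>\<in>PiE {1..n} (below n \<nu>). J n \<mu>)"
    unfolding J_def by (rule det_sum_rows) auto
  finally show ?thesis .
qed

text \<open>If \<open>\<nu>\<close> increases from one row to the next, it does so by exactly 1, and
  the two shifted rows coincide. Otherwise it decreases weakly, so failing to be a vertical strip
  means that the last part is negative, and the last row vanishes.\<close>

lemma G_not_vstrip:
  assumes dec: "antimono_on {1..n} \<rho>" and \<epsilon>: "\<epsilon> \<in> PiE {1..n} (\<lambda>_. {0, 1})" "\<epsilon> \<notin> vstrips n \<rho>"
  shows "G n (\<lambda>i. int (\<rho> i) - int (\<epsilon> i)) = 0"
proof (cases "\<exists>i\<in>{1..<n}. \<rho> i = \<rho> (Suc i) \<and> \<epsilon> i = 1 \<and> \<epsilon> (Suc i) = 0")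
  case True
  then obtain i where i: "i \<in> {1..<n}" "\<rho> i = \<rho> (Suc i)" "\<epsilon> i = 1" "\<epsilon> (Suc i) = 0"
    by blast
  show ?thesis
    unfolding G_def
    by (rule det_mat_equal_rows[of "i - 1" _ i]) (use i in \<open>auto simp: algebra_simps\<close>)
next
  case False
  have \<epsilon>01: "\<epsilon> i = 0 \<or> \<epsilon> i = 1" if "i \<in> {1..n}" for i
    using PiE_mem[OF \<epsilon>(1) that] by auto
  define \<nu> where "\<nu> i = int (\<rho> i) - int (\<epsilon> i)" for i
  have step: "\<nu> (Suc i) \<le> \<nu> i" if "i \<in> {1..<n}" for i
  proof -
    have "\<rho> (Suc i) \<le> \<rho> i"
      using dec that by (auto simp: monotone_on_def)
    moreover have "\<epsilon> i = 0 \<or> \<epsilon> i = 1" "\<epsilon> (Suc i) = 0 \<or> \<epsilon> (Suc i) = 1"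
      using \<epsilon>01 that by auto
    ultimately show ?thesis
      using False that unfolding \<nu>_def by (cases "\<rho> i = \<rho> (Suc i)") auto
  qed
  have anti: "\<nu> j \<le> \<nu> i" if "1 \<le> i" "i \<le> j" "j \<le> n" for i j
    using that(2,3)
  proof (induction j rule: dec_induct)
    case (step j)
    then show ?case
      using \<open>\<And>i. i \<in> {1..<n} \<Longrightarrow> \<nu> (Suc i) \<le> \<nu> i\<close>[of j] that(1) by auto
  qed simp
  have "\<exists>i\<in>{1..n}. \<nu> i < 0"
  proof (rule ccontr)
    assume "\<not> (\<exists>i\<in>{1..n}. \<nu> i < 0)"
    then have le: "\<epsilon> i \<le> \<rho> i" if "i \<in> {1..n}" for i
      using that unfolding \<nu>_def by force
    have "antimono_on {1..n} (\<lambda>i. \<rho> i - \<epsilon> i)"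
    proof (rule monotone_onI)
      fix i j assume "i \<in> {1..n}" "j \<in> {1..n}" "i \<le> j"
      then show "\<rho> j - \<epsilon> j \<le> \<rho> i - \<epsilon> i"
        using anti[of i j] le[of i] le[of j] unfolding \<nu>_def by auto
    qed
    with le \<epsilon> show False
      unfolding vstrips_def by blast
  qed
  then obtain i where i: "i \<in> {1..n}" "\<nu> i < 0"
    by blast
  then have "\<nu> n < 0"
    using anti[of i n] by simp
  then show ?thesis
    unfolding G_def \<nu>_def[symmetric]
    by (intro det_mat_zero_row[of "n - 1"]) (use i in \<open>auto intro!: g_neg\<close>)
qed

text \<open>By \<open>h_eq_g\<close>, the factor \<open>q powi m\<close> of \<open>h m\<close>
  splits into row and column factors whose shifts cancel in the product. The remaining two-term
  entries are expanded row by row, with \<open>\<epsilon>\<close> recording which term is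
  taken.\<close>

lemma J_rec:
  assumes dec: "antimono_on {1..n} \<rho>"
  shows "J n \<rho> = q ^ (\<Sum>i = 1..n. \<rho> i) *
    (\<Sum>\<epsilon>\<in>vstrips n \<rho>. a ^ (\<Sum>i = 1..n. \<epsilon> i) *
      (\<Sum>\<mu>\<in>PiE {1..n} (below n (\<lambda>i. \<rho> i - \<epsilon> i)). J n \<mu>))"
proof -
  let ?E = "PiE {1..n} (\<lambda>_. {0, 1 :: nat})"
  have "J n \<rho> = det (mat n n (\<lambda>(i, j). (q powi (int (\<rho> (Suc i)) - int i) * q powi int j) *
      (\<Sum>e\<in>{0, 1 :: nat}. a ^ e * g (int (\<rho> (Suc i)) - int e - int i + int j))))"
    unfolding J_def
  proof (rule det_mat_cong)
    fix i j
    let ?m = "int (\<rho> (Suc i)) - int i + int j"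
    have "(\<Sum>e\<in>{0, 1 :: nat}. a ^ e * g (int (\<rho> (Suc i)) - int e - int i + int j)) =
        g ?m + a * g (?m - 1)"
      by (simp add: algebra_simps)
    moreover have "q powi ?m = q powi (int (\<rho> (Suc i)) - int i) * q powi int j"
      by (rule power_int_add) (simp add: q_nz)
    ultimately show "h ?m = (q powi (int (\<rho> (Suc i)) - int i) * q powi int j) *
        (\<Sum>e\<in>{0, 1 :: nat}. a ^ e * g (int (\<rho> (Suc i)) - int e - int i + int j))"
      by (simp only: h_eq_g[of ?m])
  qed
  also have "\<dots> = (\<Prod>i<n. q powi (int (\<rho> (Suc i)) - int i)) * (\<Prod>j<n. q powi int j) *
      det (mat n n (\<lambda>(i, j).
        \<Sum>e\<in>{0, 1 :: nat}. a ^ e * g (int (\<rho> (Suc i)) - int e - int i + int j)))"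
    by (rule det_scale_rows_cols)
  also have "(\<Prod>i<n. q powi (int (\<rho> (Suc i)) - int i)) * (\<Prod>j<n. q powi int j) =
      (\<Prod>i<n. q ^ \<rho> (Suc i))"
    unfolding prod.distrib[symmetric]
    by (rule prod.cong) (simp_all add: power_int_diff q_nz)
  also have "\<dots> = q ^ (\<Sum>i = 1..n. \<rho> i)"
    by (simp add: power_sum prod.atLeast1_atMost_eq)
  also have "det (mat n n (\<lambda>(i, j).
        \<Sum>e\<in>{0, 1 :: nat}. a ^ e * g (int (\<rho> (Suc i)) - int e - int i + int j))) =
      (\<Sum>\<epsilon>\<in>?E. det (mat n n (\<lambda>(i, j).
        a ^ \<epsilon> (Suc i) * g (int (\<rho> (Suc i)) - int (\<epsilon> (Suc i)) - int i + int j))))"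
    by (rule det_sum_rows) simp
  also have "\<dots> = (\<Sum>\<epsilon>\<in>?E. a ^ (\<Sum>i = 1..n. \<epsilon> i) * G n (\<lambda>i. int (\<rho> i) - int (\<epsilon> i)))"
    unfolding det_scale_rows G_def by (simp add: power_sum prod.atLeast1_atMost_eq)
  also have "\<dots> = (\<Sum>\<epsilon>\<in>vstrips n \<rho>. a ^ (\<Sum>i = 1..n. \<epsilon> i) * G n (\<lambda>i. int (\<rho> i) - int (\<epsilon> i)))"
    by (rule sum.mono_neutral_right)
      (auto simp: G_not_vstrip[OF dec] vstrips_def finite_PiE)
  also have "\<dots> = (\<Sum>\<epsilon>\<in>vstrips n \<rho>. a ^ (\<Sum>i = 1..n. \<epsilon> i) *
      (\<Sum>\<mu>\<in>PiE {1..n} (below n (\<lambda>i. \<rho> i - \<epsilon> i)). J n \<mu>))"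
  proof (rule sum.cong)
    fix \<epsilon> assume \<epsilon>: "\<epsilon> \<in> vstrips n \<rho>"
    then have "G n (\<lambda>i. int (\<rho> i) - int (\<epsilon> i)) = G n (\<lambda>i. int (\<rho> i - \<epsilon> i))"
      unfolding G_def by (intro det_mat_cong) (auto simp: vstrips_def of_nat_diff)
    then show "a ^ (\<Sum>i = 1..n. \<epsilon> i) * G n (\<lambda>i. int (\<rho> i) - int (\<epsilon> i)) =
        a ^ (\<Sum>i = 1..n. \<epsilon> i) * (\<Sum>\<mu>\<in>PiE {1..n} (below n (\<lambda>i. \<rho> i - \<epsilon> i)). J n \<mu>)"
      using \<epsilon> by (subst G_eq_sum_J[symmetric]) (auto simp: vstrips_def)
  qed simp
  finally show ?thesis .
qed

end

section \<open>The hook-content product\<close>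

definition hook_length :: "nat \<Rightarrow> (nat \<Rightarrow> nat) \<Rightarrow> nat \<Rightarrow> nat \<Rightarrow> int" where
  "hook_length n \<rho> i j =
     int (\<rho> i) + int (card {k. (k, j) \<in> diagram n \<rho>}) - int i - int j + 1"

lemma le_column_iff:
  assumes dec: "antimono_on {1..n} \<rho>" and "i \<in> {1..n}" "1 \<le> j"
  shows "i \<le> card {k. (k, j) \<in> diagram n \<rho>} \<longleftrightarrow> j \<le> \<rho> i"
proof -
  let ?S = "{k. (k, j) \<in> diagram n \<rho>}"
  have "i \<le> card ?S \<longleftrightarrow> i \<in> ?S"
  proof (rule le_card_initial_segment)
    show "finite ?S"
      by (rule finite_subset[of _ "{..n}"]) auto
    show "k' \<in> ?S" if "k \<in> ?S" "1 \<le> k'" "k' \<le> k" for k k'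
      using that monotone_onD[OF dec, of k' k] by auto
  qed (use assms in auto)
  then show ?thesis
    using assms by simp
qed

lemma column_le: "card {k. (k, j) \<in> diagram n \<rho>} \<le> n"
proof -
  have "card {k. (k, j) \<in> diagram n \<rho>} \<le> card {1..n}"
    by (rule card_mono) auto
  then show ?thesis
    by simp
qed

text \<open>The beta numbers, which strictly decrease in \<open>i\<close> for a partition; if all
  parts are positive, they are the hook lengths of the first column.\<close>

definition beta :: "nat \<Rightarrow> (nat \<Rightarrow> nat) \<Rightarrow> nat \<Rightarrow> nat" where
  "beta n \<rho> i = \<rho> i + (n - i)"

text \<open>The hook lengths of row \<open>i\<close> and the differences of beta numbers are
  pairwise distinct and lie in \<open>{1..beta n \<rho> i}\<close>. There are
  \<open>\<rho> i + (n - i)\<close> of them, so they exhaust this interval.\<close>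

lemma prod_hook_lengths:
  fixes f :: "int \<Rightarrow> 'a :: comm_monoid_mult"
  assumes dec: "antimono_on {1..n} \<rho>" and i: "i \<in> {1..n}"
  shows "(\<Prod>j = 1..\<rho> i. f (hook_length n \<rho> i j)) *
      (\<Prod>k\<in>{i<..n}. f (int (beta n \<rho> i) - int (beta n \<rho> k))) =
    (\<Prod>x = 1..beta n \<rho> i. f (int x))"
proof -
  let ?c = "\<lambda>j. card {k. (k, j) \<in> diagram n \<rho>}"
  let ?d = "\<lambda>k. int (beta n \<rho> i) - int (beta n \<rho> k)"
  let ?H = "hook_length n \<rho> i ` {1..\<rho> i}" and ?D = "?d ` {i<..n}"
  have mono: "?c j' \<le> ?c j" if "j \<le> j'" "1 \<le> j" for j j'
    by (rule card_mono, rule finite_subset[of _ "{..n}"]) (use that in auto)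
  have inj1: "inj_on (hook_length n \<rho> i) {1..\<rho> i}"
  proof (rule linorder_inj_onI)
    fix j j' assume "j < j'" "j \<in> {1..\<rho> i}"
    then show "hook_length n \<rho> i j \<noteq> hook_length n \<rho> i j'"
      using mono[of j j'] by (simp add: hook_length_def)
  qed auto
  have inj2: "inj_on ?d {i<..n}"
  proof (rule linorder_inj_onI)
    fix k k' assume "k < k'" "k \<in> {i<..n}" "k' \<in> {i<..n}"
    then show "?d k \<noteq> ?d k'"
      using monotone_onD[OF dec, of k k'] i by (auto simp: beta_def)
  qed auto
  have disj: "?H \<inter> ?D = {}"
  proof -
    \<comment> \<open>The sides differ by \<open>(\<rho> k - j) + (?c j - k) + 1\<close>, taken in
      the integers. By \<open>le_column_iff\<close> the two brackets are both nonnegative or both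
      negative, so the total is not 0.\<close>
    have "hook_length n \<rho> i j \<noteq> ?d k" if "j \<in> {1..\<rho> i}" "k \<in> {i<..n}" for j k
      using le_column_iff[OF dec, of k j] that i
      by (cases "j \<le> \<rho> k") (auto simp: hook_length_def beta_def)
    then show ?thesis
      by blast
  qed
  have un: "?H \<union> ?D = int ` {1..beta n \<rho> i}"
  proof (rule card_subset_eq)
    have "hook_length n \<rho> i j \<in> {1..int (beta n \<rho> i)}" if "j \<in> {1..\<rho> i}" for j
      using le_column_iff[OF dec i, of j] column_le[of j n \<rho>] that i
      by (auto simp: hook_length_def beta_def)
    moreover have "?d k \<in> {1..int (beta n \<rho> i)}" if "k \<in> {i<..n}" for k
      using monotone_onD[OF dec, of i k] that i by (auto simp: beta_def)
    moreover have "int ` {1..beta n \<rho> i} = {1..int (beta n \<rho> i)}"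
      by (simp add: image_int_atLeastAtMost)
    ultimately show "?H \<union> ?D \<subseteq> int ` {1..beta n \<rho> i}"
      by blast
    show "card (?H \<union> ?D) = card (int ` {1..beta n \<rho> i})"
      using card_Un_disjoint[OF _ _ disj] card_image[OF inj1] card_image[OF inj2] i
      by (simp add: card_image beta_def)
  qed simp
  have "(\<Prod>j = 1..\<rho> i. f (hook_length n \<rho> i j)) * (\<Prod>k\<in>{i<..n}. f (?d k)) =
      (\<Prod>x\<in>int ` {1..beta n \<rho> i}. f x)"
    unfolding un[symmetric]
    by (simp only: prod.union_disjoint[OF _ _ disj] finite_imageI finite_atLeastAtMost
        finite_greaterThanAtMost prod.reindex[OF inj1] prod.reindex[OF inj2] o_def)
  then show ?thesis
    by (simp add: prod.reindex)
qed

section \<open>Entries of the determinant as polynomials in \<open>q ^ l\<close>\<close>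

context q_params
begin

text \<open>The part of \<open>h (l - k)\<close> common to all \<open>k < n\<close>; its denominator
  collects every factor that the shifts up to \<open>n - 1\<close> can produce.\<close>

definition phi :: "nat \<Rightarrow> nat \<Rightarrow> 'a" where
  "phi n l = h (int l) / (\<Prod>s = 1..<n. 1 + a * q powi (int l - int s))"

text \<open>Found by solving \<open>h_rec\<close> downwards \<open>k\<close> times and clearing the
  denominator of \<open>phi\<close>, with the variable standing for \<open>q ^ l\<close>. The
  products have \<open>k\<close> and \<open>n - 1 - k\<close> factors, which keeps the degree below
  \<open>n\<close>.\<close>

definition shift_poly :: "nat \<Rightarrow> nat \<Rightarrow> 'a poly" where
  "shift_poly n k = Polynomial.smult (q powi (- int k))
     ((\<Prod>s<k. [:1, - (q powi (- int s)):]) * (\<Prod>s\<in>{k<..<n}. [:1, a * q powi (- int s):]))"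

lemma degree_shift_poly:
  assumes "k < n"
  shows "degree (shift_poly n k) < n"
proof -
  let ?p = "\<Prod>s<k. [:1, - (q powi (- int s)):]" and ?r = "\<Prod>s\<in>{k<..<n}. [:1, a * q powi (- int s):]"
  have "degree (shift_poly n k) \<le> degree (?p * ?r)"
    unfolding shift_poly_def by (rule degree_smult_le)
  also have "\<dots> \<le> degree ?p + degree ?r"
    by (rule degree_mult_le)
  also have "degree ?p \<le> (\<Sum>s<k. 1)"
    by (rule order_trans[OF degree_prod_sum_le], simp, rule sum_mono) auto
  also have "degree ?r \<le> (\<Sum>s\<in>{k<..<n}. 1)"
    by (rule order_trans[OF degree_prod_sum_le], simp, rule sum_mono) auto
  finally show ?thesis
    using assms by simp
qed

lemma shift_poly_Suc:
  assumes "Suc k < n"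
  shows "q * (1 + a * q powi (- int (Suc k)) * y) * poly (shift_poly n (Suc k)) y =
    (1 - q powi (- int k) * y) * poly (shift_poly n k) y"
proof -
  let ?A = "\<lambda>k. \<Prod>s<k. 1 - q powi (- int s) * y"
  let ?B = "\<lambda>k. \<Prod>s\<in>{k<..<n}. 1 + a * q powi (- int s) * y"
  have eval: "poly (shift_poly n k) y = q powi (- int k) * (?A k * ?B k)" for k
    unfolding shift_poly_def by (simp add: poly_prod mult.commute)
  have "{k<..<n} = insert (Suc k) {Suc k<..<n}"
    using assms by auto
  then have B: "?B k = (1 + a * q powi (- int (Suc k)) * y) * ?B (Suc k)"
    by simp
  have A: "?A (Suc k) = ?A k * (1 - q powi (- int k) * y)"
    by simp
  have Q: "q powi (- int k) = q * q powi (- int (Suc k))"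
    using power_int_add[of q 1 "- int (Suc k)"] q_nz by simp
  show ?thesis
    unfolding eval A B unfolding Q by (simp only: mult_ac)
qed

text \<open>Induction with \<open>h_rec\<close>, whose factor \<open>1 + a * q powi m\<close> can be
  cancelled. For \<open>k > l\<close> both sides are 0: the factor of the polynomial with
  \<open>s = l\<close> vanishes at \<open>q ^ l\<close>.\<close>

lemma h_shift:
  assumes "k < n"
  shows "h (int l - int k) = phi n l * poly (shift_poly n k) (q ^ l)"
  using assms
proof (induction k)
  case 0
  have pow: "q powi (int l - int s) = q powi (- int s) * q ^ l" for s
    using power_int_add[of q "- int s" "int l"] q_nz by (simp add: add.commute)
  have "poly (shift_poly n 0) (q ^ l) = (\<Prod>s\<in>{0<..<n}. poly [:1, a * q powi (- int s):] (q ^ l))"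
    by (simp add: shift_poly_def poly_prod)
  also have "\<dots> = (\<Prod>s = 1..<n. 1 + a * q powi (int l - int s))"
    by (rule prod.cong) (auto simp: pow mult_ac)
  finally show ?case
    using one_plus_nz by (simp add: phi_def)
next
  case (Suc k)
  let ?m = "int l - int (Suc k)"
  have pow: "q powi (int l - int s) = q powi (- int s) * q ^ l" for s
    using power_int_add[of q "- int s" "int l"] q_nz by (simp add: add.commute)
  have "q * (1 + a * q powi ?m) * h ?m = h (int l - int k) * (1 - q powi (int l - int k))"
    using h_rec[of ?m] by simp
  also have "\<dots> = phi n l * ((1 - q powi (- int k) * q ^ l) * poly (shift_poly n k) (q ^ l))"
    using Suc by (simp add: pow)
  also have "\<dots> = phi n l * (q * (1 + a * q powi (- int (Suc k)) * q ^ l) *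
      poly (shift_poly n (Suc k)) (q ^ l))"
    using shift_poly_Suc[OF Suc.prems] by simp
  also have "\<dots> = q * (1 + a * q powi ?m) * (phi n l * poly (shift_poly n (Suc k)) (q ^ l))"
    unfolding pow by (simp add: mult_ac)
  finally show ?case
    by (subst (asm) mult_left_cancel) (use one_plus_nz q_nz in auto)
qed

section \<open>q-factorials and the content factors of a row\<close>

definition qfact :: "nat \<Rightarrow> 'a" where
  "qfact l = (\<Prod>x = 1..l. 1 - q ^ x)"

lemma qfact_Suc: "qfact (Suc l) = qfact l * (1 - q ^ Suc l)"
  by (simp add: qfact_def)

lemma phi_Suc:
  assumes "n \<ge> 1"
  shows "phi n (Suc l) * (1 - q ^ Suc l) = q * (1 + a * q powi (int l - int n + 1)) * phi n l"
proof -
  let ?D = "\<lambda>l. \<Prod>s = 1..<n. 1 + a * q powi (int l - int s)"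
  \<comment> \<open>The exponents in \<open>?D\<close> form a window of length \<open>n - 1\<close>;
    raising \<open>l\<close> by 1 moves it one place, adding \<open>l\<close> and dropping
    \<open>l - n + 1\<close>.\<close>
  have "?D (Suc l) * (1 + a * q powi (int l - int n + 1)) =
      (\<Prod>s = 1..<Suc n. 1 + a * q powi (int l + 1 - int s))"
    using assms by (simp add: algebra_simps)
  also have "\<dots> = (\<Prod>s = 0..<n. 1 + a * q powi (int l - int s))"
    using prod.shift_bounds_Suc_ivl[of "\<lambda>s. 1 + a * q powi (int l + 1 - int s)" 0 n] by simp
  also have "\<dots> = (1 + a * q ^ l) * ?D l"
    using assms by (simp add: prod.atLeast_Suc_lessThan)
  finally have D: "?D (Suc l) * (1 + a * q powi (int l - int n + 1)) = (1 + a * q ^ l) * ?D l" .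
  have nz: "?D l \<noteq> 0" for l
    using one_plus_nz by simp
  have "phi n (Suc l) * (1 - q ^ Suc l) = q * (1 + a * q ^ l) * h (int l) / ?D (Suc l)"
    using h_rec[of "int l"] power_int_of_nat[of q "Suc l"]
    by (simp add: phi_def add.commute del: power_Suc)
  also have "\<dots> = q * h (int l) * ((1 + a * q ^ l) * ?D l) / (?D (Suc l) * ?D l)"
    using nz[of l] by (simp add: mult_ac)
  also have "\<dots> = q * (1 + a * q powi (int l - int n + 1)) * phi n l"
    unfolding D[symmetric] phi_def using nz[of l] nz[of "Suc l"] by (simp add: mult_ac)
  finally show ?thesis .
qed

text \<open>Each use of \<open>phi_Suc\<close> contributes a factor \<open>q\<close> and the factor
  of one cell: for \<open>l = r + (n - i)\<close> the exponent \<open>l - n + 1\<close> is the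
  content of the cell \<open>(i, r + 1)\<close>.\<close>

lemma phi_qfact:
  assumes i: "i \<in> {1..n}"
  shows "phi n (r + (n - i)) * qfact (r + (n - i)) =
    phi n (n - i) * qfact (n - i) * q ^ r * (\<Prod>j = 1..r. 1 + a * q powi (int j - int i))"
proof (induction r)
  case (Suc r)
  let ?l = "r + (n - i)"
  have e: "int ?l - int n + 1 = int (Suc r) - int i"
    using i by auto
  have "phi n (Suc r + (n - i)) * qfact (Suc r + (n - i)) =
      (phi n (Suc ?l) * (1 - q ^ Suc ?l)) * qfact ?l"
    by (simp add: qfact_Suc mult_ac)
  also have "\<dots> = q * (1 + a * q powi (int (Suc r) - int i)) * (phi n ?l * qfact ?l)"
    using phi_Suc[of n ?l] i unfolding e by (simp add: mult_ac)
  also have "\<dots> = phi n (n - i) * qfact (n - i) * q ^ Suc r *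
      (\<Prod>j = 1..Suc r. 1 + a * q powi (int j - int i))"
    unfolding Suc by (simp add: mult_ac)
  finally show ?case .
qed simp

lemma J_zero: "J n (\<lambda>_. 0) = 1"
  unfolding J_def by (rule det_unitriangular) (auto simp: h_neg)

definition W :: "nat \<Rightarrow> (nat \<Rightarrow> nat) \<Rightarrow> 'a" where
  "W n \<rho> = (\<Prod>i = 1..n. phi n (beta n \<rho> i) * (\<Prod>m = 1..<i. q ^ beta n \<rho> i - q ^ beta n \<rho> m))"

text \<open>In beta numbers, column \<open>j\<close> has the entries \<open>h (l - k)\<close> with
  \<open>k = n - 1 - j\<close>: up to a row factor, a polynomial fixed by the column at a node fixed
  by the row. So \<open>det_poly_nodes\<close> leaves a coefficient determinant that is independent
  of \<open>\<rho>\<close>.\<close>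

lemma J_eq_W: "\<exists>C. \<forall>\<rho>. J n \<rho> = C * W n \<rho>"
proof -
  let ?P = "\<lambda>j. shift_poly n (n - Suc j)"
  have "J n \<rho> = det (mat n n (\<lambda>(i, j). coeff (?P j) i)) * W n \<rho>" for \<rho>
  proof -
    let ?l = "\<lambda>i. beta n \<rho> (Suc i)"
    have inner: "(\<Prod>m = 1..<Suc i. f m) = (\<Prod>m<i. f (Suc m))" for i and f :: "nat \<Rightarrow> 'a"
      using prod.shift_bounds_Suc_ivl[of f 0 i] by (simp add: atLeast0LessThan)
    have "J n \<rho> = det (mat n n (\<lambda>(i, j). phi n (?l i) * poly (?P j) (q ^ ?l i)))"
      unfolding J_def
    proof (rule det_mat_cong)
      fix i j assume ij: "i < n" "j < n"
      then have e: "int (\<rho> (Suc i)) - int i + int j = int (?l i) - int (n - Suc j)"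
        and lt: "n - Suc j < n"
        by (auto simp: beta_def)
      show "h (int (\<rho> (Suc i)) - int i + int j) = phi n (?l i) * poly (?P j) (q ^ ?l i)"
        unfolding e by (rule h_shift[OF lt])
    qed
    also have "\<dots> = (\<Prod>i<n. phi n (?l i)) * ((\<Prod>i<n. \<Prod>m<i. q ^ ?l i - q ^ ?l m) *
        det (mat n n (\<lambda>(i, j). coeff (?P j) i)))"
      unfolding det_scale_rows by (subst det_poly_nodes) (auto intro!: degree_shift_poly)
    also have "(\<Prod>i<n. \<Prod>m<i. q ^ ?l i - q ^ ?l m) =
        (\<Prod>i = 1..n. \<Prod>m = 1..<i. q ^ beta n \<rho> i - q ^ beta n \<rho> m)"
      by (simp only: One_nat_def prod.atLeast1_atMost_eq inner[unfolded One_nat_def])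
    finally show ?thesis
      by (simp add: W_def prod.distrib prod.atLeast1_atMost_eq mult_ac)
  qed
  then show ?thesis
    by blast
qed

definition hook_content :: "nat \<Rightarrow> (nat \<Rightarrow> nat) \<Rightarrow> 'a" where
  "hook_content n \<rho> = (\<Prod>i = 1..n. q ^ (i * \<rho> i) *
     (\<Prod>j = 1..\<rho> i. (1 + a * q powi (int j - int i)) / (1 - q powi hook_length n \<rho> i j)))"

lemma hook_nz:
  assumes "antimono_on {1..n} \<rho>" "i \<in> {1..n}" "j \<in> {1..\<rho> i}"
  shows "1 - q powi hook_length n \<rho> i j \<noteq> 0"
proof -
  have "hook_length n \<rho> i j > 0"
    using le_column_iff[OF assms(1,2), of j] assms(3) by (auto simp: hook_length_def)
  then obtain k where "hook_length n \<rho> i j = int k" "k > 0"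
    by (metis pos_int_cases)
  then show ?thesis
    using one_minus_nz[of k] by simp
qed

lemma W_eq:
  assumes dec: "antimono_on {1..n} \<rho>"
  shows "W n \<rho> = (\<Prod>i = 1..n. phi n (n - i) * qfact (n - i) * q ^ ((i - 1) * (n - i))) *
    hook_content n \<rho>"
proof -
  let ?b = "beta n \<rho>"
  let ?N = "\<lambda>i. \<Prod>j = 1..\<rho> i. 1 + a * q powi (int j - int i)"
  let ?H = "\<lambda>i. \<Prod>j = 1..\<rho> i. 1 - q powi hook_length n \<rho> i j"
  let ?D = "\<lambda>i. \<Prod>k\<in>{i<..n}. 1 - q powi (int (?b i) - int (?b k))"
  have H: "?H i \<noteq> 0" if "i \<in> {1..n}" for i
    using hook_nz[OF dec that] by simp
  have D: "?D i = qfact (?b i) / ?H i" if "i \<in> {1..n}" for i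
    using prod_hook_lengths[OF dec that, of "\<lambda>x. 1 - q powi x"] H[OF that]
    by (simp add: qfact_def eq_divide_eq mult.commute)
  have "W n \<rho> = (\<Prod>i = 1..n. phi n (?b i) * q ^ ((i - 1) * ?b i) *
      (\<Prod>m = 1..<i. 1 - q powi (int (?b m) - int (?b i))))"
    unfolding W_def
  proof (rule prod.cong)
    fix i
    have "q ^ ?b i - q ^ ?b m = q ^ ?b i * (1 - q powi (int (?b m) - int (?b i)))" for m
      using q_nz by (simp add: power_int_diff algebra_simps)
    then show "phi n (?b i) * (\<Prod>m = 1..<i. q ^ ?b i - q ^ ?b m) =
        phi n (?b i) * q ^ ((i - 1) * ?b i) * (\<Prod>m = 1..<i. 1 - q powi (int (?b m) - int (?b i)))"
      by (simp add: prod.distrib power_mult[symmetric] mult.commute mult.left_commute)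
  qed simp
  also have "\<dots> = (\<Prod>i = 1..n. phi n (?b i) * q ^ ((i - 1) * ?b i)) *
      (\<Prod>i = 1..n. \<Prod>m\<in>{m \<in> {1..n}. m < i}. 1 - q powi (int (?b m) - int (?b i)))"
    unfolding prod.distrib by (intro arg_cong2[of _ _ _ _ "(*)"] prod.cong) auto
  \<comment> \<open>Regrouped by the smaller index, the factors of row \<open>m\<close> are those
    that complement its hook lengths.\<close>
  also have "(\<Prod>i = 1..n. \<Prod>m\<in>{m \<in> {1..n}. m < i}. 1 - q powi (int (?b m) - int (?b i))) =
      (\<Prod>m = 1..n. \<Prod>i\<in>{i \<in> {1..n}. m < i}. 1 - q powi (int (?b m) - int (?b i)))"
    by (rule prod.swap_restrict) auto
  also have "\<dots> = (\<Prod>i = 1..n. ?D i)"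
    by (intro prod.cong) auto
  also have "(\<Prod>i = 1..n. phi n (?b i) * q ^ ((i - 1) * ?b i)) * (\<Prod>i = 1..n. ?D i) =
      (\<Prod>i = 1..n. (phi n (n - i) * qfact (n - i) * q ^ ((i - 1) * (n - i))) *
        (q ^ (i * \<rho> i) * (\<Prod>j = 1..\<rho> i.
          (1 + a * q powi (int j - int i)) / (1 - q powi hook_length n \<rho> i j))))"
    unfolding prod.distrib[symmetric]
  proof (rule prod.cong)
    fix i assume i: "i \<in> {1..n}"
    have "phi n (?b i) * q ^ ((i - 1) * ?b i) * ?D i =
        (phi n (?b i) * qfact (?b i)) * q ^ ((i - 1) * ?b i) / ?H i"
      by (simp only: D[OF i]) simp
    also have "\<dots> = phi n (n - i) * qfact (n - i) * q ^ \<rho> i * ?N i *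
        q ^ ((i - 1) * \<rho> i + (i - 1) * (n - i)) / ?H i"
      unfolding beta_def phi_qfact[OF i] by (simp only: add_mult_distrib2)
    also have "\<dots> = (phi n (n - i) * qfact (n - i) * q ^ ((i - 1) * (n - i))) *
          (q ^ (\<rho> i + (i - 1) * \<rho> i) * (?N i / ?H i))"
      by (simp add: power_add mult_ac)
    \<comment> \<open>One factor \<open>q ^ \<rho> i\<close> comes from \<open>phi_qfact\<close>,
      and \<open>i - 1\<close> more from the powers pulled out of the Vandermonde product.\<close>
    also have "\<rho> i + (i - 1) * \<rho> i = i * \<rho> i"
      using i by (cases i) auto
    finally show "phi n (?b i) * q ^ ((i - 1) * ?b i) * ?D i =
        (phi n (n - i) * qfact (n - i) * q ^ ((i - 1) * (n - i))) *
          (q ^ (i * \<rho> i) * (\<Prod>j = 1..\<rho> i.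
            (1 + a * q powi (int j - int i)) / (1 - q powi hook_length n \<rho> i j)))"
      by (simp only: prod_dividef)
  qed simp
  finally show ?thesis
    unfolding hook_content_def prod.distrib .
qed

text \<open>The determinant of the change of basis is read off from the empty partition.\<close>

theorem J_eq_hook_content:
  assumes "antimono_on {1..n} \<rho>"
  shows "J n \<rho> = hook_content n \<rho>"
proof -
  obtain C where C: "J n \<rho> = C * W n \<rho>" for \<rho>
    using J_eq_W by blast
  let ?K = "\<Prod>i = 1..n. phi n (n - i) * qfact (n - i) * q ^ ((i - 1) * (n - i))"
  have "1 = C * (?K * hook_content n (\<lambda>_. 0))"
    using C[of "\<lambda>_. 0"] W_eq[of n "\<lambda>_. 0"] by (simp add: J_zero monotone_on_def)
  also have "hook_content n (\<lambda>_. 0) = 1"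
    by (simp add: hook_content_def)
  finally have "C * ?K = 1"
    by simp
  then show ?thesis
    unfolding C W_eq[OF assms] mult.assoc[symmetric] by simp
qed

end

section \<open>Laurent series\<close>

text \<open>Two series are \<open>q\<close>-adically close once their coefficients agree up to a
  high index. Each coefficient receives finitely many contributions and negative exponents are
  excluded, so the finite set \<open>X\<close> settles all coefficients up to
  \<open>N\<close>.\<close>

lemma has_sum_fls:
  fixes f :: "'i \<Rightarrow> 'a :: ab_group_add fls"
  assumes fin: "\<And>k. finite {x \<in> A. fls_nth (f x) k \<noteq> 0}"
    and neg: "\<And>x k. x \<in> A \<Longrightarrow> k < 0 \<Longrightarrow> fls_nth (f x) k = 0" "\<And>k. k < 0 \<Longrightarrow> fls_nth S k = 0"
    and nth: "\<And>k. fls_nth S k = (\<Sum>x\<in>{x \<in> A. fls_nth (f x) k \<noteq> 0}. fls_nth (f x) k)"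
  shows "(f has_sum S) A"
  unfolding has_sum_def tendsto_iff
proof (intro allI impI)
  fix e :: real assume "e > 0"
  then obtain N :: nat where N: "inverse (2 ^ N) < e"
    using real_arch_pow_inv[of e "1 / 2"] by (auto simp: power_one_over inverse_eq_divide)
  define X where "X = (\<Union>k\<in>{0..int N}. {x \<in> A. fls_nth (f x) k \<noteq> 0})"
  have "dist (sum f Y) S < e" if Y: "finite Y" "X \<subseteq> Y" "Y \<subseteq> A" for Y
  proof -
    have eq: "fls_nth (sum f Y) k = fls_nth S k" if "k \<le> int N" for k
    proof (cases "k < 0")
      case True
      then show ?thesis
        using neg Y(3) by (auto simp: fls_nth_sum intro!: sum.neutral)
    next
      case False
      then have "{x \<in> A. fls_nth (f x) k \<noteq> 0} \<subseteq> Y"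
        using Y(2) that unfolding X_def by force
      then have "(\<Sum>x\<in>Y. fls_nth (f x) k) = (\<Sum>x\<in>{x \<in> A. fls_nth (f x) k \<noteq> 0}. fls_nth (f x) k)"
        using Y by (intro sum.mono_neutral_right) auto
      then show ?thesis
        by (simp add: nth fls_nth_sum)
    qed
    show ?thesis
    proof (cases "sum f Y = S")
      case False
      have "fls_subdegree (sum f Y - S) > int N"
      proof (rule ccontr)
        assume "\<not> ?thesis"
        then have "fls_nth (sum f Y - S) (fls_subdegree (sum f Y - S)) = 0"
          using eq by simp
        then show False
          using False nth_fls_subdegree_nonzero[of "sum f Y - S"] by simp
      qed
      then obtain d where d: "fls_subdegree (sum f Y - S) = int d" "N < d"
        by (intro that[of "nat (fls_subdegree (sum f Y - S))"]) auto
      have "dist (sum f Y) S = inverse (2 ^ d)"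
        using False d by (simp add: dist_fls_def)
      also have "\<dots> \<le> inverse (2 ^ N)"
        using d by (intro le_imp_inverse_le power_increasing) auto
      finally show ?thesis
        using N by simp
    qed (use \<open>e > 0\<close> in simp)
  qed
  moreover have "finite X" "X \<subseteq> A"
    using fin unfolding X_def by auto
  ultimately show "eventually (\<lambda>Y. dist (sum f Y) S < e) (finite_subsets_at_top A)"
    unfolding eventually_finite_subsets_at_top by blast
qed

section \<open>Laurent series without negative exponents\<close>

definition power_series :: "'a :: comm_ring_1 fls \<Rightarrow> bool" where
  "power_series f \<longleftrightarrow> (\<forall>k<0. fls_nth f k = 0)"

lemma power_series_fps [simp]: "power_series (fps_to_fls f)"
  by (simp add: power_series_def)

lemma power_series_iff: "power_series f \<longleftrightarrow> (\<exists>g. f = fps_to_fls g)"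
proof
  assume "power_series f"
  then have "f = fps_to_fls (fls_regpart f)"
    by (intro fls_eqI) (auto simp: power_series_def)
  then show "\<exists>g. f = fps_to_fls g" ..
qed auto

lemma power_series_1 [simp]: "power_series 1"
  by (simp add: power_series_def)

lemma power_series_0 [simp]: "power_series 0"
  by (simp add: power_series_def)

lemma power_series_mult: "power_series f \<Longrightarrow> power_series g \<Longrightarrow> power_series (f * g)"
  by (auto simp: power_series_iff fls_times_fps_to_fls[symmetric])

lemma power_series_diff: "power_series f \<Longrightarrow> power_series g \<Longrightarrow> power_series (f - g)"
  by (simp add: power_series_def)

lemma power_series_sum: "(\<And>x. x \<in> A \<Longrightarrow> power_series (f x)) \<Longrightarrow> power_series (sum f A)"
  by (simp add: power_series_def fls_nth_sum)

lemma power_series_prod: "(\<And>x. x \<in> A \<Longrightarrow> power_series (f x)) \<Longrightarrow> power_series (prod f A)"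
  by (induction A rule: infinite_finite_induct) (auto intro: power_series_mult)

text \<open>Checked on single coefficients: \<open>qvar ^ k\<close> has no constant term for
  \<open>k > 0\<close>, and \<open>1 + avar * qvar powi k\<close> has at \<open>k\<close> the
  coefficient \<open>a\<close> or \<open>1 + a\<close>, with \<open>a\<close> the
  indeterminate.\<close>

interpretation Q: q_params avar qvar
proof
  show "qvar \<noteq> 0"
    by (simp add: qvar_def)
  show "qvar ^ k \<noteq> 1" if "k > 0" for k
  proof
    assume "qvar ^ k = 1"
    then have "fls_nth (qvar ^ k) 0 = 1"
      by simp
    then show False
      using that by (simp add: qvar_def fls_X_power_conv_shift_1)
  qed
  have a_ne: "to_fract [:0, 1 :: int:] \<noteq> - 1"
  proof
    assume "to_fract [:0, 1 :: int:] = - 1"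
    then have "to_fract [:0, 1 :: int:] = to_fract (- 1)"
      by simp
    then show False
      by (simp only: to_fract_eq_iff) (simp add: one_pCons)
  qed
  show "1 + avar * qvar powi k \<noteq> 0" for k
  proof
    assume "1 + avar * qvar powi k = 0"
    moreover have "fls_nth (1 + avar * qvar powi k) k =
        (if k = 0 then 1 else 0) + to_fract [:0, 1:]"
      by (simp add: avar_def qvar_def fls_X_power_int)
    ultimately show False
      using a_ne by (auto simp: add_eq_0_iff split: if_splits)
  qed
qed

lemma power_series_power: "power_series f \<Longrightarrow> power_series (f ^ k)"
  by (induction k) (auto intro: power_series_mult)

lemma power_series_avar [simp]: "power_series avar"
  by (simp add: avar_def power_series_def)

text \<open>The denominators \<open>1 - qvar ^ i\<close> have constant term 1, so their inverses are
  power series. Together with \<open>Q.J_rec\<close> this makes the coefficients of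
  \<open>Q.J n \<rho>\<close> below the size of the shape vanish.\<close>

lemma power_series_J: "power_series (Q.J n \<rho>)"
proof -
  have frac: "power_series ((1 + avar * qvar ^ i) / (1 - qvar ^ i))" if "i \<ge> 1" for i
  proof -
    have "1 - qvar ^ i = fps_to_fls (1 - fps_X ^ i)"
      by (simp add: qvar_def fls_X_conv_shift_1 fps_to_fls_power)
    moreover have "subdegree (1 - fps_X ^ i :: int poly fract fps) = 0"
      using that by (simp add: subdegree_eq_0_iff)
    ultimately have "inverse (1 - qvar ^ i) = fps_to_fls (inverse (1 - fps_X ^ i))"
      by (simp only: fls_inverse_fps_to_fls)
    moreover have "power_series (1 - (- avar * qvar ^ i))"
      by (intro power_series_diff power_series_mult power_series_power)
        (simp_all add: avar_def qvar_def power_series_def)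
    ultimately show ?thesis
      unfolding divide_inverse by (intro power_series_mult) auto
  qed
  then have "power_series (Q.g m)" for m
    unfolding Q.g_def by (auto intro!: power_series_prod)
  then have h: "power_series (Q.h m)" for m
    unfolding Q.h_def by (intro power_series_diff)
  have "power_series (signof p :: int poly fract fls)" for p :: "nat \<Rightarrow> nat"
    by (cases "sign p = 1") (auto simp: sign_def power_series_def)
  with h show ?thesis
    unfolding Q.J_def det_mat
    by (auto intro!: power_series_sum power_series_mult power_series_prod)
qed

lemma below_antimono:
  assumes "\<mu> \<in> PiE {1..n} (below n \<nu>)" "antimono_on {1..n} \<nu>"
  shows "antimono_on {1..n} \<mu>"
proof (rule monotone_onI)
  fix i i' assume i: "i \<in> {1..n}" "i' \<in> {1..n}" "i \<le> i'"
  show "\<mu> i' \<le> \<mu> i"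
  proof (cases "i = i'")
    case False
    have "\<mu> i' \<le> \<nu> i'"
      using PiE_mem[OF assms(1) i(2)] by simp
    also have "\<dots> \<le> \<nu> (Suc i)"
      using assms(2) i False by (auto simp: monotone_on_def)
    also have "\<dots> \<le> \<mu> i"
      using PiE_mem[OF assms(1) i(1)] i False by auto
    finally show ?thesis .
  qed simp
qed

lemma nth_avar_qvar: "fls_nth (avar ^ i * f) k = to_fract [:0, 1:] ^ i * fls_nth f k"
  by (induction i) (simp_all add: avar_def mult.assoc)

lemma nth_qvar_mult: "fls_nth (qvar ^ m * f) k = fls_nth f (k - int m)"
  by (simp add: qvar_def fls_X_power_times_conv_shift)

text \<open>Both sides satisfy the same recursion, which lowers \<open>N\<close> by the size of the
  shape. It makes no progress for the empty shape, which is settled directly; below the size of the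
  shape both sides are 0.\<close>

lemma weight_sum_eq_nth_J:
  assumes "antimono_on {1..n} \<rho>"
  shows "weight_sum (to_fract [:0, 1:]) n \<rho> N = fls_nth (Q.J n \<rho>) (int N)"
  using assms
proof (induction N arbitrary: \<rho> rule: less_induct)
  case (less N)
  let ?s = "\<Sum>i = 1..n. \<rho> i" and ?a = "to_fract [:0, 1 :: int:]"
  consider "?s = 0" | "N < ?s" | "0 < ?s" "?s \<le> N"
    by linarith
  then show ?case
  proof cases
    case 1
    then have "diagram n \<rho> = {}"
      by (auto simp: diagram_def)
    moreover have "fillings_of_size {} N = (if N = 0 then {\<lambda>_. undefined} else {})"
      by (auto simp: fillings_of_size_def overpartition_fillings_def size_on_def)
    ultimately have "weight_sum ?a n \<rho> N = (if N = 0 then 1 else 0)"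
      by (simp add: weight_sum_def overlined_on_def)
    moreover have "Q.J n \<rho> = Q.J n (\<lambda>_. 0)"
      unfolding Q.J_def using 1 by (intro det_mat_cong) simp
    ultimately show ?thesis
      by (simp add: Q.J_zero)
  next
    case 2
    have "power_series (\<Sum>\<epsilon>\<in>vstrips n \<rho>. avar ^ (\<Sum>i = 1..n. \<epsilon> i) *
        (\<Sum>\<mu>\<in>PiE {1..n} (below n (\<lambda>i. \<rho> i - \<epsilon> i)). Q.J n \<mu>))"
      by (intro power_series_sum power_series_mult power_series_power power_series_J
          power_series_avar)
    with 2 show ?thesis
      by (subst Q.J_rec[OF less.prems])
        (simp add: weight_sum_small nth_qvar_mult power_series_def del: of_nat_sum)
  next
    case 3
    define M where "M = N - ?s"
    have N: "N = M + ?s" and "M < N"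
      using 3 by (auto simp: M_def)
    have IH: "weight_sum ?a n \<mu> M = fls_nth (Q.J n \<mu>) (int M)"
      if "\<epsilon> \<in> vstrips n \<rho>" "\<mu> \<in> PiE {1..n} (below n (\<lambda>i. \<rho> i - \<epsilon> i))" for \<epsilon> \<mu>
      using that below_antimono by (intro less.IH[OF \<open>M < N\<close>]) (auto simp: vstrips_def)
    have "fls_nth (Q.J n \<rho>) (int N) = fls_nth (\<Sum>\<epsilon>\<in>vstrips n \<rho>. avar ^ (\<Sum>i = 1..n. \<epsilon> i) *
        (\<Sum>\<mu>\<in>PiE {1..n} (below n (\<lambda>i. \<rho> i - \<epsilon> i)). Q.J n \<mu>)) (int M)"
      by (subst Q.J_rec[OF less.prems]) (simp add: nth_qvar_mult N)
    also have "\<dots> = weight_sum ?a n \<rho> N"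
      unfolding N weight_sum_rec[OF less.prems] fls_nth_sum nth_avar_qvar
      by (intro sum.cong arg_cong2[of _ _ _ _ "(*)"]) (auto simp: IH)
    finally show ?thesis ..
  qed
qed

lemma plane_overpartitions_eq:
  "plane_overpartitions lam = overpartition_fillings (cells lam)"
  by (simp add: plane_overpartitions_def overpartition_fillings_def)

theorem theorem3:
  fixes lam :: "nat list"
  assumes "is_partition lam"
  shows "((\<lambda>P. avar ^ num_overlined lam P * qvar ^ size_of lam P) has_sum
      qvar ^ (\<Sum>i=1..length lam. i * part lam i) *
      (\<Prod>(i, j)\<in>cells lam.
        (1 + avar * qvar powi cell_content i j) / (1 - qvar powi hook lam i j)))
    (plane_overpartitions lam)"
proof -
  let ?n = "length lam" and ?\<rho> = "part lam" and ?a = "to_fract [:0, 1 :: int:]"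
  have cells: "cells lam = diagram ?n ?\<rho>"
    by (simp add: cells_def diagram_def)
  have dec: "antimono_on {1..?n} ?\<rho>"
  proof (rule monotone_onI)
    fix i j assume "i \<in> {1..?n}" "j \<in> {1..?n}" "i \<le> j"
    then show "part lam j \<le> part lam i"
      using assms unfolding is_partition_def part_def sorted_wrt_iff_nth_less
      by (cases "i = j") auto
  qed
  have hook: "hook lam i j = hook_length ?n ?\<rho> i j" for i j
    by (simp add: hook_def hook_length_def conj_part_def cells)
  have "qvar ^ (\<Sum>i=1..?n. i * part lam i) * (\<Prod>(i, j)\<in>cells lam.
      (1 + avar * qvar powi cell_content i j) / (1 - qvar powi hook lam i j)) = Q.J ?n ?\<rho>"
    unfolding Q.J_eq_hook_content[OF dec] Q.hook_content_def cells diagram_eq_Sigma hook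
      cell_content_def prod.distrib power_sum
    by (subst prod.Sigma) auto
  moreover have "((\<lambda>P. avar ^ num_overlined lam P * qvar ^ size_of lam P) has_sum Q.J ?n ?\<rho>)
    (plane_overpartitions lam)"
  proof (rule has_sum_fls)
    have nth: "fls_nth (avar ^ num_overlined lam P * qvar ^ size_of lam P) k =
        (if k = int (size_of lam P) then ?a ^ num_overlined lam P else 0)" for P k
      using nth_qvar_mult[of "size_of lam P" 1 k] by (simp add: nth_avar_qvar)
    \<comment> \<open>A filling contributes to the coefficient at \<open>k\<close> only if its size
      is \<open>k\<close>, and then by a power of the indeterminate, which is not 0.\<close>
    have set: "{P \<in> plane_overpartitions lam.
        fls_nth (avar ^ num_overlined lam P * qvar ^ size_of lam P) k \<noteq> 0} =
        (if k < 0 then {} else fillings_of_size (diagram ?n ?\<rho>) (nat k))" for k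
      unfolding nth
      by (auto simp: plane_overpartitions_eq cells fillings_of_size_def size_of_def size_on_def
          simp del: of_nat_sum)
    show "finite {P \<in> plane_overpartitions lam.
        fls_nth (avar ^ num_overlined lam P * qvar ^ size_of lam P) k \<noteq> 0}" for k
      unfolding set by (simp add: finite_fillings_of_size)
    show neg: "fls_nth (Q.J ?n ?\<rho>) k = 0" if "k < 0" for k
      using power_series_J that by (simp add: power_series_def)
    show "fls_nth (avar ^ num_overlined lam P * qvar ^ size_of lam P) k = 0" if "k < 0" for P k
      using that by (simp add: nth)
    show "fls_nth (Q.J ?n ?\<rho>) k = (\<Sum>P\<in>{P \<in> plane_overpartitions lam.
        fls_nth (avar ^ num_overlined lam P * qvar ^ size_of lam P) k \<noteq> 0}.
        fls_nth (avar ^ num_overlined lam P * qvar ^ size_of lam P) k)" for k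
    proof (cases "k < 0")
      case True
      then show ?thesis
        unfolding set by (simp add: neg)
    next
      case False
      then have "fls_nth (Q.J ?n ?\<rho>) k = weight_sum ?a ?n ?\<rho> (nat k)"
        using weight_sum_eq_nth_J[OF dec, of "nat k"] by simp
      then show ?thesis
        using False unfolding set nth weight_sum_def
        by (auto intro!: sum.cong simp: fillings_of_size_def size_of_def size_on_def cells
            num_overlined_def overlined_on_def plane_overpartitions_eq simp del: of_nat_sum)
    qed
  qed
  ultimately show ?thesis
    by simp
qed

end
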